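(* Consider competing first-passage percolation on $\mathbb{Z}^2$ with i.i.d. edge passage times whose common distribution is continuous, supported on $[0,\infty)$, and satisfies $\mathbb{E}\big[\min\{\omega_1,\omega_2,\omega_3,\omega_4\}^2\big]<\infty$, where $\omega_1,\ldots,\omega_4$ are independent passage times with this distribution. Let $\theta\in[0,2\pi)$, and suppose that, with probability one, there exists a geodesic in $\mathcal{T}_0$ whose Busemann function is asymptotically linear with direction $\theta$. Then, for $\alpha\in[0,\pi]$, $\mathbb{P}(G_{\theta,\alpha})>0$ if $\alpha<\pi/2$, and $\mathbb{P}(G_{\theta,\alpha})=0$ if $\alpha>\pi/2$.
   Context: Passage times: the nearest-neighbor edges $e$ of $\mathbb{Z}^2$ carry i.i.d. random weights $\omega_e$. A path is a nearest-neighbor path in $\mathbb{Z}^2$. For a path $\Gamma$ set $T(\Gamma)=\sum_{e\in\Gamma}\omega_e$, for $x,y\in\mathbb{Z}^2$ set $T(x,y)=\inf\{T(\Gamma):\Gamma\text{ is a path connecting }x\text{ and }y\}$, and for $I\subseteq\mathbb{Z}^2$ set $T(I,z)=\inf_{x\in I}T(x,z)$ (with $\inf\emptyset=+\infty$). Almost surely the infimum defining $T(x,y)$ is attained by a unique path, called the geodesic between $x$ and $y$. Asymptotic shape: under the stated assumptions there is a deterministic norm $\mu$ on $\mathbb{R}^2$ such that almost surely $\limsup_{|x|\to\infty}|T(0,x)-\mu(x)|/|x|=0$. The asymptotic shape is $\mathcal{A}=\{x\in\mathbb{R}^2:\mu(x)\le1\}$. Infinite geodesics and Busemann functions: an infinite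 geodesic is an infinite nearest-neighbor path $(v_1,v_2,\ldots)$ every finite segment of which is the geodesic between its endpoints. $\mathcal{T}_0$ is the set of infinite geodesics starting at the origin. For $g=(v_1,v_2,\ldots)\in\mathcal{T}_0$ the Busemann function is $B_g(x,y)=\lim_{k\to\infty}[T(x,v_k)-T(y,v_k)]$, $x,y\in\mathbb{Z}^2$ (almost surely the limit exists for all $g\in\mathcal{T}_0$ and $x,y$ simultaneously). Direction: a supporting line of $\mathcal{A}$ is a line containing at least one point of $\mathcal{A}$ and such that $\mathcal{A}$ lies in one of the two closed half-planes bounded by it. A linear functional $\rho:\mathbb{R}^2\to\mathbb{R}$ is supporting if $\{x:\rho(x)=1\}$ is a supporting line of $\mathcal{A}$. For each $\theta\in[0,2\pi)$ there is exactly one supporting functional $\rho$ whose gradient is a positive multiple of $(\cos\theta,\sin\theta)$. The Busemann function of $g$ is asymptotically linear with direction $\theta$ if, for this $\rho$, $\limsup_{|y|\to\infty}\frac{1}{|y|}|B_g(0,y)-\rho(y)|=0$. Competition: given disjoint $I_1,I_2\subseteq\mathbb{Z}^2$ (initial sets of type 1 and type 2), the set of sites eventually occupied by type 2 is $\mathcal{E}_2=\{z\in\mathbb{Z}^2:T(I_2,z)<T(I_1,z)\}$, and type 2 is said to survive if $\mathcal{E}_2$ is infinite. Cones: $\mathcal{C}_\alpha^\theta$ denotes the (closed) cone with apex at the origin and angle $\alpha$ around the half-line from the origin through $-(\cos\theta,\sin\theta)$, i.e. the origin together with all points $x$ whose angle with $-(\cos\theta,\sin\theta)$ is at most $\alpha$.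 The event $G_{\theta,\alpha}$ is the event that type 2 survives when started from $I_1=(\mathcal{C}_\alpha^\theta\setminus\{0\})\cap\mathbb{Z}^2$ and $I_2=\{0\}$. *)

theory Defs
  imports "HOL-Probability.Probability"
begin

type_synonym site = "int \<times> int"
type_synonym plane = "real \<times> real"

definition emb :: "site \<Rightarrow> plane" where
  "emb z = (real_of_int (fst z), real_of_int (snd z))"

definition adj :: "site \<Rightarrow> site \<Rightarrow> bool" where
  "adj x y \<longleftrightarrow> \<bar>fst x - fst y\<bar> + \<bar>snd x - snd y\<bar> = 1"

definition edges :: "site set set" where
  "edges = {{x, y} | x y. adj x y}"

text \<open>Below, \<open>w\<close> is a single realisation of the edge weights. A path is given by its nonempty list of
  vertices; an edge that it crosses repeatedly is counted with multiplicity in its passage time.\<close>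

definition is_path :: "site list \<Rightarrow> bool" where
  "is_path p \<longleftrightarrow> p \<noteq> [] \<and> (\<forall>i. Suc i < length p \<longrightarrow> adj (p ! i) (p ! Suc i))"

definition path_between :: "site \<Rightarrow> site \<Rightarrow> site list \<Rightarrow> bool" where
  "path_between x y p \<longleftrightarrow> is_path p \<and> hd p = x \<and> last p = y"

definition path_time :: "(site set \<Rightarrow> real) \<Rightarrow> site list \<Rightarrow> real" where
  "path_time w p = (\<Sum>i<length p - 1. w {p ! i, p ! Suc i})"

definition passage_time :: "(site set \<Rightarrow> real) \<Rightarrow> site \<Rightarrow> site \<Rightarrow> real" where
  "passage_time w x y = (INF p\<in>{p. path_between x y p}. path_time w p)"

text \<open>Extended reals, so that the infimum over the empty set is \<open>\<infinity>\<close>.\<close>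

definition set_passage_time :: "(site set \<Rightarrow> real) \<Rightarrow> site set \<Rightarrow> site \<Rightarrow> ereal" where
  "set_passage_time w I z = (INF x\<in>I. ereal (passage_time w x z))"

definition is_geodesic :: "(site set \<Rightarrow> real) \<Rightarrow> site \<Rightarrow> site \<Rightarrow> site list \<Rightarrow> bool" where
  "is_geodesic w x y p \<longleftrightarrow>
     path_between x y p \<and> path_time w p = passage_time w x y \<and>
     (\<forall>q. path_between x y q \<and> path_time w q = passage_time w x y \<longrightarrow> q = p)"

definition infinite_geodesic :: "(site set \<Rightarrow> real) \<Rightarrow> (nat \<Rightarrow> site) \<Rightarrow> bool" where
  "infinite_geodesic w v \<longleftrightarrow>
     (\<forall>k. adj (v k) (v (Suc k))) \<and>
     (\<forall>m n. m \<le> n \<longrightarrow> is_geodesic w (v m) (v n) (map v [m..<Suc n]))"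

definition geodesics_from_origin :: "(site set \<Rightarrow> real) \<Rightarrow> (nat \<Rightarrow> site) set" where
  "geodesics_from_origin w = {v. infinite_geodesic w v \<and> v 0 = 0}"

definition busemann :: "(site set \<Rightarrow> real) \<Rightarrow> (nat \<Rightarrow> site) \<Rightarrow> site \<Rightarrow> site \<Rightarrow> real" where
  "busemann w v x y = lim (\<lambda>k. passage_time w x (v k) - passage_time w y (v k))"

text \<open>The filter of lattice points \<open>x\<close> with \<open>|x| \<rightarrow> \<infinity>\<close>.\<close>

definition site_at_infinity :: "site filter" where
  "site_at_infinity = filtercomap (\<lambda>x. norm (emb x)) at_top"

definition is_norm :: "(plane \<Rightarrow> real) \<Rightarrow> bool" where
  "is_norm \<mu> \<longleftrightarrow>
     (\<forall>x. 0 \<le> \<mu> x) \<and> (\<forall>x. \<mu> x = 0 \<longleftrightarrow> x = 0) \<and>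
     (\<forall>c x. \<mu> (c *\<^sub>R x) = \<bar>c\<bar> * \<mu> x) \<and> (\<forall>x y. \<mu> (x + y) \<le> \<mu> x + \<mu> y)"

text \<open>The norm of the shape theorem. A norm with the stated property is unique, because its values on
  the lattice are limits of \<open>T(0,nx)/n\<close>; it exists under the moment condition of the main theorem.\<close>

definition shape_norm :: "'a measure \<Rightarrow> (site set \<Rightarrow> 'a \<Rightarrow> real) \<Rightarrow> plane \<Rightarrow> real" where
  "shape_norm M \<omega> = (THE \<mu>. is_norm \<mu> \<and>
     (AE s in M. Limsup site_at_infinity
        (\<lambda>x. ereal (\<bar>passage_time (\<lambda>e. \<omega> e s) 0 x - \<mu> (emb x)\<bar> / norm (emb x))) = 0))"

definition asymptotic_shape :: "'a measure \<Rightarrow> (site set \<Rightarrow> 'a \<Rightarrow> real) \<Rightarrow> plane set" where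
  "asymptotic_shape M \<omega> = {x. shape_norm M \<omega> x \<le> 1}"

definition supporting_line :: "plane set \<Rightarrow> plane set \<Rightarrow> bool" where
  "supporting_line A L \<longleftrightarrow>
     (\<exists>a b. a \<noteq> 0 \<and> L = {x. a \<bullet> x = b} \<and> L \<inter> A \<noteq> {} \<and>
        (A \<subseteq> {x. a \<bullet> x \<le> b} \<or> A \<subseteq> {x. a \<bullet> x \<ge> b}))"

definition supporting_functional :: "plane set \<Rightarrow> (plane \<Rightarrow> real) \<Rightarrow> bool" where
  "supporting_functional A \<rho> \<longleftrightarrow> linear \<rho> \<and> supporting_line A {x. \<rho> x = 1}"

definition unit_vec :: "real \<Rightarrow> plane" where
  "unit_vec \<theta> = (cos \<theta>, sin \<theta>)"

text \<open>The supporting functional with gradient in direction \<open>\<theta>\<close> is unique, so it does not matter that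
  it is bound by an existential quantifier.\<close>

definition busemann_asymp_linear ::
    "plane set \<Rightarrow> (site set \<Rightarrow> real) \<Rightarrow> (nat \<Rightarrow> site) \<Rightarrow> real \<Rightarrow> bool" where
  "busemann_asymp_linear A w v \<theta> \<longleftrightarrow>
     (\<exists>\<rho>. supporting_functional A \<rho> \<and>
          (\<exists>c>0. \<forall>x. \<rho> x = (c *\<^sub>R unit_vec \<theta>) \<bullet> x) \<and>
          Limsup site_at_infinity
            (\<lambda>y. ereal (1 / norm (emb y) * \<bar>busemann w v 0 y - \<rho> (emb y)\<bar>)) = 0)"

definition occupied2 :: "(site set \<Rightarrow> real) \<Rightarrow> site set \<Rightarrow> site set \<Rightarrow> site set" where
  "occupied2 w I1 I2 = {z. set_passage_time w I2 z < set_passage_time w I1 z}"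

definition type2_survives :: "(site set \<Rightarrow> real) \<Rightarrow> site set \<Rightarrow> site set \<Rightarrow> bool" where
  "type2_survives w I1 I2 \<longleftrightarrow> infinite (occupied2 w I1 I2)"

definition angle_between :: "plane \<Rightarrow> plane \<Rightarrow> real" where
  "angle_between x y = arccos (x \<bullet> y / (norm x * norm y))"

definition cone :: "real \<Rightarrow> real \<Rightarrow> plane set" where
  "cone \<theta> \<alpha> = insert 0 {x. x \<noteq> 0 \<and> angle_between x (- unit_vec \<theta>) \<le> \<alpha>}"

definition event_G :: "'a measure \<Rightarrow> (site set \<Rightarrow> 'a \<Rightarrow> real) \<Rightarrow> real \<Rightarrow> real \<Rightarrow> 'a set" where
  "event_G M \<omega> \<theta> \<alpha> =
     {s \<in> space M. type2_survives (\<lambda>e. \<omega> e s) {z. emb z \<in> cone \<theta> \<alpha> - {0}} {0}}"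

end

theory Submission
  imports Defs
begin

text \<open>
  Let \<open>v\<close> be a geodesic from the origin, \<open>T\<close> the passage time and \<open>B(0,y)\<close> the Busemann function of \<open>v\<close>.
  The triangle inequality makes \<open>T(0,v\<^sub>k) - T(y,v\<^sub>k)\<close> increasing in \<open>k\<close>, so that it is bounded by its
  limit \<open>B(0,y)\<close> uniformly in \<open>k\<close>. This uniformity replaces any use of the shape theorem.

  If \<open>\<alpha> < \<pi>/2\<close>, then \<open>B(0,y)\<close> tends to \<open>-\<infinity>\<close> on the cone, so it has a maximiser there; let \<open>x\<close> be the
  lowest one. The cone is convex, so the cone translated to \<open>x\<close> lies in the cone, and \<open>B(0,y) < B(0,x)\<close> for all
  its points \<open>y \<noteq> x\<close>, with a uniform gap. Hence \<open>x\<close> reaches \<open>v\<^sub>k\<close> before the rest of its translated cone for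
  all large \<open>k\<close>. Almost surely this happens for some \<open>x\<close>, and by translation invariance the probability does
  not depend on \<open>x\<close>.

  If \<open>\<alpha> > \<pi>/2\<close>, then the cone contains points \<open>y\<^sub>1\<close>, \<open>y\<^sub>2\<close> on the left and on the right of direction \<open>\<theta>\<close> for which
  \<open>B(0,y\<^sub>i)\<close> exceeds all values of \<open>B(0,\<cdot>)\<close> near the ray opposite to \<open>\<theta>\<close>. Fast paths from \<open>y\<^sub>i\<close> to \<open>v\<^sub>k\<close> avoid this
  ray, and they avoid the sites that type 2 reaches first. If type 2 survived, these sites would contain a path
  from the origin to a far point inside the complement of the cone; together with the ray, it separates
  \<open>y\<^sub>1\<close> from \<open>y\<^sub>2\<close>, a contradiction.
\<close>

section \<open>Paths and passage times\<close>

lemma edges_memI: "adj x y \<Longrightarrow> {x, y} \<in> edges"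
  unfolding edges_def by blast

lemma is_path_singleton [simp]: "is_path [x]"
  by (simp add: is_path_def)

lemma is_path_Nil [simp]: "\<not> is_path []"
  by (simp add: is_path_def)

lemma is_path_Cons_Cons [simp]: "is_path (x # y # p) \<longleftrightarrow> adj x y \<and> is_path (y # p)"
  by (auto simp: is_path_def nth_Cons split: nat.splits)

lemma path_time_singleton [simp]: "path_time w [x] = 0"
  by (simp add: path_time_def)

lemma path_time_Cons_Cons [simp]: "path_time w (x # y # p) = w {x, y} + path_time w (y # p)"
  by (simp add: path_time_def sum.lessThan_Suc_shift del: sum.lessThan_Suc)

lemma is_path_append: "is_path (p @ x # q) \<longleftrightarrow> is_path (p @ [x]) \<and> is_path (x # q)"
proof (induction p)
  case (Cons a p)
  then show ?case by (cases p) auto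
qed simp

lemma path_time_append: "path_time w (p @ x # q) = path_time w (p @ [x]) + path_time w (x # q)"
proof (induction p)
  case (Cons a p)
  then show ?case by (cases p) auto
qed simp

lemma path_between_singleton: "path_between x x [x]"
  by (simp add: path_between_def)

lemma path_between_obtain_ends:
  assumes "path_between x y p"
  obtains q r where "p = q @ [y]" "p = x # r"
  using assms by (metis append_butlast_last_id is_path_Nil list.collapse path_between_def)

lemma path_between_append:
  assumes "path_between x y p" "path_between y z q"
  obtains r where "path_between x z r" "path_time w r = path_time w p + path_time w q"
proof -
  obtain p' where p: "p = p' @ [y]" using path_between_obtain_ends[OF assms(1)] by metis
  obtain q' where q: "q = y # q'" using path_between_obtain_ends[OF assms(2)] by metis
  show thesis
  proof (rule that[of "p' @ y # q'"])
    show "path_between x z (p' @ y # q')"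
      using assms is_path_append[of p' y q'] unfolding path_between_def p q
      by (auto simp: hd_append split: if_splits)
    show "path_time w (p' @ y # q') = path_time w p + path_time w q"
      using path_time_append[of w p' y q'] by (simp add: p q)
  qed
qed

lemma path_between_split:
  assumes "path_between x z p" "y \<in> set p"
  obtains q r where "path_between x y q" "path_between y z r"
    "path_time w p = path_time w q + path_time w r"
proof -
  obtain q' r' where p: "p = q' @ y # r'" using assms(2) by (meson split_list)
  show thesis
  proof (rule that[of "q' @ [y]" "y # r'"])
    show "path_between x y (q' @ [y])" "path_between y z (y # r')"
      using assms is_path_append[of q' y r'] unfolding path_between_def p
      by (auto simp: hd_append split: if_splits)
  qed (simp add: p path_time_append[of w q' y r'])
qed

text \<open>The infimum in \<open>passage_time\<close> thus ranges over a nonempty set. The path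
  runs horizontally first, then vertically.\<close>

lemma path_between_exists: "\<exists>p. path_between x y p"
proof -
  have trans: "\<exists>p. path_between x z p" if "\<exists>p. path_between x y p" "\<exists>p. path_between y z p" for x y z
    using that path_between_append by metis
  have edge: "\<exists>p. path_between x y p" if "adj x y" for x y
    by (rule exI[of _ "[x, y]"]) (simp add: path_between_def that)
  have horizontal: "\<exists>p. path_between (a, b) (a + i, b) p" for a b i
  proof (induction i rule: int_induct[where k = 0])
    case base
    show ?case using path_between_singleton by auto
  next
    case (step1 i)
    show ?case by (rule trans[OF step1(2)], rule edge) (simp add: adj_def)
  next
    case (step2 i)
    show ?case by (rule trans[OF step2(2)], rule edge) (simp add: adj_def)
  qed
  have vertical: "\<exists>p. path_between (a, b) (a, b + i) p" for a b i
  proof (induction i rule: int_induct[where k = 0])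
    case base
    show ?case using path_between_singleton by auto
  next
    case (step1 i)
    show ?case by (rule trans[OF step1(2)], rule edge) (simp add: adj_def)
  next
    case (step2 i)
    show ?case by (rule trans[OF step2(2)], rule edge) (simp add: adj_def)
  qed
  obtain a b c d where "x = (a, b)" "y = (c, d)" by fastforce
  with trans[of "(a, b)" "(c, b)" "(c, d)"] horizontal[of a b "c - a"] vertical[of c b "d - b"]
  show ?thesis by simp
qed

text \<open>Only values on \<open>edges\<close> are constrained, since nothing is known of the
  weights elsewhere. Deterministic statements are proved for fixed weights of this kind; almost
  every realisation is one.\<close>

definition nonneg_weights :: "(site set \<Rightarrow> real) \<Rightarrow> bool" where
  "nonneg_weights w \<longleftrightarrow> (\<forall>e\<in>edges. 0 \<le> w e)"

lemma path_time_nonneg: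
  assumes "nonneg_weights w" "is_path p"
  shows "0 \<le> path_time w p"
  using assms(2)
proof (induction p rule: induct_list012)
  case (3 x y zs)
  then show ?case using assms(1) edges_memI[of x y] by (auto simp: nonneg_weights_def)
qed simp_all

lemma passage_time_le:
  assumes "nonneg_weights w" "path_between x y p"
  shows "passage_time w x y \<le> path_time w p"
  unfolding passage_time_def
proof (rule cINF_lower)
  show "bdd_below (path_time w ` {p. path_between x y p})"
    using assms(1) by (intro bdd_belowI[of _ 0]) (auto simp: path_between_def path_time_nonneg)
qed (use assms in simp)

lemma passage_time_greatest:
  assumes "\<And>p. path_between x y p \<Longrightarrow> c \<le> path_time w p"
  shows "c \<le> passage_time w x y"
  unfolding passage_time_def using assms path_between_exists[of x y] by (intro cINF_greatest) auto

text \<open>The strict bound lets a near-optimal path stand in for a minimising one.\<close>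

lemma passage_time_less_obtain:
  assumes "passage_time w x y < c"
  obtains p where "path_between x y p" "path_time w p < c"
  using assms passage_time_greatest[of x y c w] by (meson linorder_not_le)

lemma passage_time_nonneg: "nonneg_weights w \<Longrightarrow> 0 \<le> passage_time w x y"
  by (rule passage_time_greatest) (simp add: path_between_def path_time_nonneg)

lemma passage_time_self: "nonneg_weights w \<Longrightarrow> passage_time w x x = 0"
  using passage_time_le[of w x x "[x]"] passage_time_nonneg[of w x x] path_between_singleton
  by simp

lemma passage_time_triangle:
  assumes "nonneg_weights w"
  shows "passage_time w x z \<le> passage_time w x y + passage_time w y z"
proof -
  have "passage_time w x z \<le> path_time w p + path_time w q"
    if "path_between x y p" "path_between y z q" for p q
    using path_between_append[OF that, of w] passage_time_le[OF assms] by metis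
  then have "passage_time w x z - path_time w q \<le> passage_time w x y" if "path_between y z q" for q
    using that by (intro passage_time_greatest) (simp add: diff_le_eq)
  then have "passage_time w x z - passage_time w x y \<le> passage_time w y z"
    by (intro passage_time_greatest) (simp add: algebra_simps)
  then show ?thesis by simp
qed

lemma passage_time_via:
  assumes "nonneg_weights w" "path_between x z p" "y \<in> set p"
  shows "passage_time w x y + passage_time w y z \<le> path_time w p"
  using path_between_split[OF assms(2,3), of w] passage_time_le[OF assms(1)] by (metis add_mono)

section \<open>Busemann functions\<close>

text \<open>\<open>v k\<close> lies on the geodesic from the origin to \<open>v (Suc k)\<close>, so
  the triangle inequality is an equality there.\<close>

lemma geodesic_passage_time_Suc:
  assumes "nonneg_weights w" "v \<in> geodesics_from_origin w"
  shows "passage_time w 0 (v (Suc k)) = passage_time w 0 (v k) + passage_time w (v k) (v (Suc k))"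
proof -
  have "is_geodesic w (v 0) (v (Suc k)) (map v [0..<Suc (Suc k)])" "v 0 = 0"
    using assms(2) unfolding geodesics_from_origin_def infinite_geodesic_def by blast+
  moreover have "v k \<in> set (map v [0..<Suc (Suc k)])" by simp
  ultimately have "passage_time w 0 (v k) + passage_time w (v k) (v (Suc k)) \<le> passage_time w 0 (v (Suc k))"
    using passage_time_via[OF assms(1)] unfolding is_geodesic_def by metis
  then show ?thesis using passage_time_triangle[OF assms(1)] by (meson order_antisym)
qed

text \<open>A repeated vertex would start and end a segment of positive length that is the unique
  geodesic between its ends, but the one-vertex path attains the passage time 0 as well.\<close>

lemma geodesic_inj:
  assumes "nonneg_weights w" "v \<in> geodesics_from_origin w"
  shows "inj v"
proof (rule linorder_injI)
  fix m n :: nat assume "m < n"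
  show "v m \<noteq> v n"
  proof
    assume eq: "v m = v n"
    have "is_geodesic w (v m) (v n) (map v [m..<Suc n])"
      using assms(2) \<open>m < n\<close> by (simp add: geodesics_from_origin_def infinite_geodesic_def)
    moreover have "path_between (v m) (v n) [v m]" "path_time w [v m] = passage_time w (v m) (v n)"
      using eq passage_time_self[OF assms(1)] by (auto simp: path_between_singleton)
    ultimately have "[v m] = map v [m..<Suc n]" unfolding is_geodesic_def by blast
    then have "length [v m] = length (map v [m..<Suc n])" by (rule arg_cong)
    with \<open>m < n\<close> show False by simp
  qed
qed

text \<open>Passing from \<open>k\<close> to \<open>Suc k\<close> raises T(0, v k) by exactly T(v k,
  v (Suc k)), and T(y, v k) by at most that.\<close>

lemma busemann_incseq:
  assumes "nonneg_weights w" "v \<in> geodesics_from_origin w"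
  shows "incseq (\<lambda>k. passage_time w 0 (v k) - passage_time w y (v k))"
proof (rule incseq_SucI)
  fix k
  show "passage_time w 0 (v k) - passage_time w y (v k)
      \<le> passage_time w 0 (v (Suc k)) - passage_time w y (v (Suc k))"
    using geodesic_passage_time_Suc[OF assms, of k]
      passage_time_triangle[OF assms(1), of y "v (Suc k)" "v k"] by simp
qed

text \<open>The sequence is increasing and bounded by T(0, y), so the limit exists and
  \<open>lim\<close> has its intended value.\<close>

lemma busemann_tendsto:
  assumes "nonneg_weights w" "v \<in> geodesics_from_origin w"
  shows "(\<lambda>k. passage_time w 0 (v k) - passage_time w y (v k)) \<longlonglongrightarrow> busemann w v 0 y"
proof -
  have "passage_time w 0 (v k) - passage_time w y (v k) \<le> passage_time w 0 y" for k
    using passage_time_triangle[OF assms(1), of 0 "v k" y] by simp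
  then obtain L where "(\<lambda>k. passage_time w 0 (v k) - passage_time w y (v k)) \<longlonglongrightarrow> L"
    using incseq_convergent[OF busemann_incseq[OF assms]] by blast
  then show ?thesis unfolding busemann_def using limI by metis
qed

text \<open>An increasing sequence stays below its limit. As this holds at every \<open>k\<close>, a
  single \<open>k\<close> serves infinitely many \<open>y\<close> at once.\<close>

lemma le_busemann:
  assumes "nonneg_weights w" "v \<in> geodesics_from_origin w"
  shows "passage_time w 0 (v k) - passage_time w y (v k) \<le> busemann w v 0 y"
  using incseq_le[OF busemann_incseq[OF assms] busemann_tendsto[OF assms]] .

lemma busemann_origin:
  assumes "nonneg_weights w" "v \<in> geodesics_from_origin w"
  shows "busemann w v 0 0 = 0"
  using busemann_tendsto[OF assms, of 0] by (simp add: LIMSEQ_const_iff)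

section \<open>Lattice points, cones and linear growth\<close>

lemma emb_0 [simp]: "emb 0 = 0"
  by (simp add: emb_def zero_prod_def)

lemma emb_diff: "emb (x - y) = emb x - emb y"
  by (simp add: emb_def)

lemma emb_eq_iff [simp]: "emb x = emb y \<longleftrightarrow> x = y"
  by (simp add: emb_def prod_eq_iff)

lemma emb_eq_0_iff [simp]: "emb x = 0 \<longleftrightarrow> x = 0"
  using emb_eq_iff[of x 0] by simp

lemma finite_norm_emb_le: "finite {z. norm (emb z) \<le> r}"
proof (rule finite_subset)
  show "{z. norm (emb z) \<le> r} \<subseteq> {-\<lceil>r\<rceil>..\<lceil>r\<rceil>} \<times> {-\<lceil>r\<rceil>..\<lceil>r\<rceil>}"
  proof
    fix z assume "z \<in> {z. norm (emb z) \<le> r}"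
    then have "\<bar>real_of_int (fst z)\<bar> \<le> r" "\<bar>real_of_int (snd z)\<bar> \<le> r"
      using norm_fst_le[of "fst (emb z)" "snd (emb z)"] norm_snd_le[of "snd (emb z)" "fst (emb z)"]
      by (auto simp: emb_def)
    then show "z \<in> {-\<lceil>r\<rceil>..\<lceil>r\<rceil>} \<times> {-\<lceil>r\<rceil>..\<lceil>r\<rceil>}"
      by (auto simp: mem_Times_iff) linarith+
  qed
qed simp

lemma emb_near: "\<exists>z. norm (emb z - x) \<le> 2"
proof
  let ?z = "(\<lfloor>fst x\<rfloor>, \<lfloor>snd x\<rfloor>)"
  have "norm (emb ?z - x) \<le> \<bar>fst (emb ?z - x)\<bar> + \<bar>snd (emb ?z - x)\<bar>"
    using norm_Pair_le[of "fst (emb ?z - x)" "snd (emb ?z - x)"] by (simp only: prod.collapse real_norm_def)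
  also have "\<dots> \<le> 2" unfolding emb_def by simp linarith
  finally show "norm (emb ?z - x) \<le> 2" .
qed

lemma norm_unit_vec [simp]: "norm (unit_vec \<theta>) = 1"
  by (simp add: unit_vec_def norm_Pair)

text \<open>Cosine decreases on [0, pi], so the angle bound is a bound on a normalised inner
  product. Multiplied by the norm, it also covers the apex.\<close>

lemma mem_cone_iff:
  assumes "0 \<le> \<alpha>" "\<alpha> \<le> pi"
  shows "x \<in> cone \<theta> \<alpha> \<longleftrightarrow> unit_vec \<theta> \<bullet> x \<le> - cos \<alpha> * norm x"
proof (cases "x = 0")
  case False
  let ?c = "x \<bullet> (- unit_vec \<theta>) / (norm x * norm (- unit_vec \<theta>))"
  have c: "\<bar>?c\<bar> \<le> 1"
    using Cauchy_Schwarz_ineq2[of x "- unit_vec \<theta>"] False by (simp add: abs_mult)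
  have "x \<in> cone \<theta> \<alpha> \<longleftrightarrow> arccos ?c \<le> \<alpha>" using False by (simp add: cone_def angle_between_def)
  also have "\<dots> \<longleftrightarrow> arccos ?c \<le> arccos (cos \<alpha>)" using assms by (simp add: arccos_cos)
  also have "\<dots> \<longleftrightarrow> cos \<alpha> \<le> ?c" using c by (intro arccos_le_mono) auto
  also have "\<dots> \<longleftrightarrow> unit_vec \<theta> \<bullet> x \<le> - cos \<alpha> * norm x"
    using False by (auto simp: field_simps inner_commute)
  finally show ?thesis .
qed (simp add: cone_def)

lemma busemann_asymp_linearD:
  assumes "busemann_asymp_linear A w v \<theta>"
  obtains c where "0 < c"
    "\<And>\<epsilon>. 0 < \<epsilon> \<Longrightarrow> \<exists>N. \<forall>y. N \<le> norm (emb y) \<longrightarrow>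
       \<bar>busemann w v 0 y - c * (unit_vec \<theta> \<bullet> emb y)\<bar> \<le> \<epsilon> * norm (emb y)"
proof -
  obtain \<rho> c where c: "0 < c" "\<And>x. \<rho> x = (c *\<^sub>R unit_vec \<theta>) \<bullet> x"
    and lim: "Limsup site_at_infinity
       (\<lambda>y. ereal (1 / norm (emb y) * \<bar>busemann w v 0 y - \<rho> (emb y)\<bar>)) = 0"
    using assms unfolding busemann_asymp_linear_def by blast
  show thesis
  proof (rule that[OF c(1)])
    fix \<epsilon> :: real assume "0 < \<epsilon>"
    then have "eventually (\<lambda>y. ereal (1 / norm (emb y) * \<bar>busemann w v 0 y - \<rho> (emb y)\<bar>) < ereal \<epsilon>)
        site_at_infinity"
      using lim by (intro Limsup_lessD) simp
    then obtain N where N: "\<And>y. N \<le> norm (emb y) \<Longrightarrow>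
        1 / norm (emb y) * \<bar>busemann w v 0 y - \<rho> (emb y)\<bar> < \<epsilon>"
      unfolding site_at_infinity_def eventually_filtercomap_at_top_linorder less_ereal.simps by blast
    \<comment> \<open>The lower bound 1 keeps the norm positive, so the division can be
      undone.\<close>
    have "\<bar>busemann w v 0 y - c * (unit_vec \<theta> \<bullet> emb y)\<bar> \<le> \<epsilon> * norm (emb y)"
      if "max N 1 \<le> norm (emb y)" for y
    proof -
      have "1 / norm (emb y) * \<bar>busemann w v 0 y - \<rho> (emb y)\<bar> < \<epsilon>" using that N[of y] by linarith
      moreover have "0 < norm (emb y)" using that by linarith
      ultimately show ?thesis by (simp add: c field_simps)
    qed
    then show "\<exists>N. \<forall>y. N \<le> norm (emb y) \<longrightarrow>
       \<bar>busemann w v 0 y - c * (unit_vec \<theta> \<bullet> emb y)\<bar> \<le> \<epsilon> * norm (emb y)" by blast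
  qed
qed

section \<open>Survival in narrow cones\<close>

text \<open>Only finitely many values exceed \<open>b - 1\<close>, so a strict pointwise bound
  improves to one with a uniform gap.\<close>

lemma finite_le_bound:
  fixes f :: "'a \<Rightarrow> real"
  assumes "finite {y \<in> Y. b - 1 < f y}" "\<And>y. y \<in> Y \<Longrightarrow> f y < b"
  obtains m where "m < b" "\<And>y. y \<in> Y \<Longrightarrow> f y \<le> m"
proof -
  let ?F = "insert (b - 1) (f ` {y \<in> Y. b - 1 < f y})"
  have fin: "finite ?F" using assms(1) by simp
  show thesis
  proof (rule that[of "Max ?F"])
    show "Max ?F < b" using fin assms(2) by (subst Max_less_iff) auto
    show "f y \<le> Max ?F" if "y \<in> Y" for y
    proof (cases "b - 1 < f y")
      case True
      then show ?thesis using that by (intro Max_ge[OF fin]) auto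
    next
      case False
      then show ?thesis using Max_ge[OF fin, of "b - 1"] by simp
    qed
  qed
qed

lemma exists_translate_type2_survives:
  assumes nonneg: "nonneg_weights w" and v: "v \<in> geodesics_from_origin w"
    and lin: "busemann_asymp_linear A w v \<theta>" and \<alpha>: "0 \<le> \<alpha>" "\<alpha> < pi / 2"
  shows "\<exists>x. type2_survives w {z. emb (z - x) \<in> cone \<theta> \<alpha> - {0}} {x}"
proof -
  define B where "B = busemann w v 0"
  define u where "u = unit_vec \<theta>"
  define \<kappa> where "\<kappa> = cos \<alpha>"
  have \<kappa>: "0 < \<kappa>" unfolding \<kappa>_def using \<alpha> by (intro cos_gt_zero_pi) auto
  have cone: "x \<in> cone \<theta> \<alpha> \<longleftrightarrow> u \<bullet> x \<le> - \<kappa> * norm x" for x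
    unfolding u_def \<kappa>_def using \<alpha> by (intro mem_cone_iff) auto
  define C where "C = {z. emb z \<in> cone \<theta> \<alpha>}"
  obtain c where c: "0 < c"
    and asymp: "\<And>\<epsilon>. 0 < \<epsilon> \<Longrightarrow> \<exists>N. \<forall>y. N \<le> norm (emb y) \<longrightarrow>
       \<bar>B y - c * (u \<bullet> emb y)\<bar> \<le> \<epsilon> * norm (emb y)"
    unfolding B_def u_def using busemann_asymp_linearD[OF lin] by blast
  have finite_superlevel: "finite {z \<in> C. r < B z}" for r
  proof -
    \<comment> \<open>On the cone the linear term is at most \<open>- c * \<kappa>\<close> times the
      norm; half of this is given to the error.\<close>
    define \<epsilon> where "\<epsilon> = c * \<kappa> / 2"
    have "0 < \<epsilon>" using c \<kappa> by (simp add: \<epsilon>_def)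
    then obtain N where N: "\<bar>B y - c * (u \<bullet> emb y)\<bar> \<le> \<epsilon> * norm (emb y)" if "N \<le> norm (emb y)" for y
      using asymp by blast
    have "norm (emb z) \<le> max N (\<bar>r\<bar> / \<epsilon>)" if z: "z \<in> C" "r < B z" for z
    proof (cases "N \<le> norm (emb z)")
      case True
      have "c * (u \<bullet> emb z) \<le> c * (- \<kappa> * norm (emb z))"
        using z(1) c by (intro mult_left_mono) (auto simp: C_def cone)
      also have "\<dots> = - 2 * (\<epsilon> * norm (emb z))" by (simp add: \<epsilon>_def)
      finally have "r < - (\<epsilon> * norm (emb z))"
        using abs_le_D1[OF N[OF True]] z(2) by linarith
      then have "norm (emb z) < \<bar>r\<bar> / \<epsilon>"
        using \<open>0 < \<epsilon>\<close> by (simp add: field_simps)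
      then show ?thesis by simp
    qed simp
    then show ?thesis by (intro finite_subset[OF _ finite_norm_emb_le]) auto
  qed
  have B0: "B 0 = 0" unfolding B_def by (rule busemann_origin[OF nonneg v])
  have "0 \<in> C" by (simp add: C_def cone)
  obtain m0 where m0: "m0 \<in> C" "\<And>z. z \<in> C \<Longrightarrow> B z \<le> B m0"
  proof -
    \<comment> \<open>The level -1 lies below \<open>B 0 = 0\<close>, so this finite set is nonempty
      and its maximiser is a maximiser over all of \<open>C\<close>.\<close>
    let ?S = "{z \<in> C. -1 < B z}"
    have "0 \<in> ?S" using \<open>0 \<in> C\<close> B0 by simp
    then have "?S \<noteq> {}" by blast
    then obtain m where "is_arg_min (\<lambda>z. - B z) (\<lambda>z. z \<in> ?S) m"
      using ex_is_arg_min_if_finite[OF finite_superlevel[of "-1"]] by blast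
    then have m: "m \<in> ?S" "\<And>z. z \<in> ?S \<Longrightarrow> B z \<le> B m"
      by (auto simp: is_arg_min_linorder)
    show thesis
    proof (rule that[of m])
      show "B z \<le> B m" if "z \<in> C" for z
        using m(2)[of z] m(1) that by (cases "-1 < B z") auto
    qed (use m in auto)
  qed
  \<comment> \<open>Ties are broken by taking the lowest maximiser. All other points of the cone
    translated to \<open>x\<close> are lower than \<open>x\<close>, so none of them is a
    maximiser.\<close>
  obtain x where x: "x \<in> C" "B x = B m0" "\<And>z. z \<in> C \<Longrightarrow> B z = B m0 \<Longrightarrow> u \<bullet> emb x \<le> u \<bullet> emb z"
  proof -
    let ?S = "{z \<in> C. B z = B m0}"
    have "finite ?S" by (rule finite_subset[OF _ finite_superlevel[of "B m0 - 1"]]) auto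
    moreover have "?S \<noteq> {}" using m0(1) by blast
    ultimately obtain x where "is_arg_min (\<lambda>z. u \<bullet> emb z) (\<lambda>z. z \<in> ?S) x"
      using ex_is_arg_min_if_finite by blast
    then show thesis by (intro that[of x]) (auto simp: is_arg_min_linorder)
  qed
  define Y where "Y = {z. emb (z - x) \<in> cone \<theta> \<alpha> - {0}}"
  have Y: "y \<in> C \<and> B y < B x" if "y \<in> Y" for y
  proof -
    have yx: "u \<bullet> emb (y - x) \<le> - \<kappa> * norm (emb (y - x))" "emb (y - x) \<noteq> 0"
      using that by (auto simp: Y_def cone)
    have "0 < \<kappa> * norm (emb (y - x))" using yx(2) \<kappa> by simp
    then have less: "u \<bullet> emb y < u \<bullet> emb x" using yx(1) by (simp add: emb_diff inner_diff_right)
    \<comment> \<open>Since y = x + (y - x), adding the two cone inequalities and using the triangle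
      inequality puts \<open>y\<close> in the cone.\<close>
    have "norm (emb y) \<le> norm (emb x) + norm (emb (y - x))"
      using norm_triangle_ineq[of "emb x" "emb (y - x)"] by (simp add: emb_diff)
    then have "\<kappa> * norm (emb y) \<le> \<kappa> * norm (emb x) + \<kappa> * norm (emb (y - x))"
      using \<kappa> by (simp flip: distrib_left)
    then have "y \<in> C"
      using x(1) yx(1) by (simp add: C_def cone emb_diff inner_diff_right)
    moreover have "B y \<noteq> B m0" using x(3)[of y] less \<open>y \<in> C\<close> by auto
    ultimately show ?thesis using m0(2)[of y] x(2) by simp
  qed
  obtain m where m: "m < B x" "\<And>y. y \<in> Y \<Longrightarrow> B y \<le> m"
  proof (rule finite_le_bound)
    show "finite {y \<in> Y. B x - 1 < B y}"
      by (rule finite_subset[OF _ finite_superlevel[of "B x - 1"]]) (use Y in auto)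
  qed (use Y in auto)
  have "eventually (\<lambda>k. m < passage_time w 0 (v k) - passage_time w x (v k)) sequentially"
    using busemann_tendsto[OF nonneg v, of x] m(1) unfolding B_def by (rule order_tendstoD)
  then obtain k0 where k0: "\<And>k. k0 \<le> k \<Longrightarrow> m < passage_time w 0 (v k) - passage_time w x (v k)"
    unfolding eventually_sequentially by blast
  have "v k \<in> occupied2 w Y {x}" if "k0 \<le> k" for k
  proof -
    \<comment> \<open>By \<open>le_busemann\<close>, every \<open>y\<close> in \<open>Y\<close>
      needs at least T(0, v k) - m to reach \<open>v k\<close>, whereas \<open>k0\<close> makes
      \<open>x\<close> need less.\<close>
    have "ereal (passage_time w 0 (v k) - m) \<le> set_passage_time w Y (v k)"
      unfolding set_passage_time_def
    proof (rule INF_greatest)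
      fix y assume "y \<in> Y"
      then show "ereal (passage_time w 0 (v k) - m) \<le> ereal (passage_time w y (v k))"
        using m(2)[of y] le_busemann[OF nonneg v, of k y] unfolding B_def by simp
    qed
    moreover have "ereal (passage_time w x (v k)) < ereal (passage_time w 0 (v k) - m)"
      using k0[OF that] by simp
    ultimately have "ereal (passage_time w x (v k)) < set_passage_time w Y (v k)"
      by (rule order.strict_trans2[rotated])
    then show ?thesis by (simp add: occupied2_def set_passage_time_def[of w "{x}"])
  qed
  then have "v ` {k0..} \<subseteq> occupied2 w Y {x}" by auto
  moreover have "infinite (v ` {k0..})"
    using geodesic_inj[OF nonneg v] by (simp add: finite_image_iff inj_on_subset infinite_Ici)
  ultimately show ?thesis
    unfolding type2_survives_def Y_def using finite_subset by blast
qed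

section \<open>Crossing paths in the plane\<close>

text \<open>The continuous injection \<open>V\<close> transfers \<open>fashoda\<close> from
  \<open>real ^ 2\<close> to pairs.\<close>

lemma fashoda_prod:
  fixes f g :: "real \<Rightarrow> real \<times> real"
  assumes "path f" "path g" "path_image f \<subseteq> cbox (a1, a2) (b1, b2)" "path_image g \<subseteq> cbox (a1, a2) (b1, b2)"
    and "fst (pathstart f) = a1" "fst (pathfinish f) = b1"
    and "snd (pathstart g) = a2" "snd (pathfinish g) = b2"
  shows "path_image f \<inter> path_image g \<noteq> {}"
proof -
  define V :: "real \<times> real \<Rightarrow> real ^ 2" where "V p = (\<chi> i. if i = 1 then fst p else snd p)" for p
  have V: "V p $ 1 = fst p" "V p $ 2 = snd p" for p by (simp_all add: V_def)
  have cont: "continuous_on S V" for S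
    unfolding V_def
  proof (intro continuous_on_vec_lambda)
    show "continuous_on S (\<lambda>p. if i = 1 then fst p else snd p)" for i :: 2
      by (cases "i = 1") (auto intro!: continuous_intros)
  qed
  have inj: "V p = V q \<longleftrightarrow> p = q" for p q by (simp add: vec_eq_iff forall_2 V prod_eq_iff)
  have sub: "path_image (V \<circ> h) \<subseteq> cbox (V (a1, a2)) (V (b1, b2))"
    if "path_image h \<subseteq> cbox (a1, a2) (b1, b2)" for h
    using that unfolding path_image_compose by (force simp: mem_box_cart forall_2 V cbox_Pair_eq)
  obtain z where "z \<in> path_image (V \<circ> f)" "z \<in> path_image (V \<circ> g)"
  proof (rule fashoda)
    show "path (V \<circ> f)" "path (V \<circ> g)"
      using assms(1,2) cont by (auto intro: path_continuous_image)
    show "path_image (V \<circ> f) \<subseteq> cbox (V (a1, a2)) (V (b1, b2))"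
      "path_image (V \<circ> g) \<subseteq> cbox (V (a1, a2)) (V (b1, b2))"
      using assms(3,4) by (auto dest: sub)
  qed (use assms(5-8) in \<open>simp_all add: pathstart_compose pathfinish_compose V\<close>)
  then show ?thesis by (auto simp: path_image_compose inj)
qed

text \<open>Extend \<open>\<gamma>\<close> horizontally to the left and right sides of a large box,
  and \<open>\<eta>\<close> vertically from 0 to the bottom and from \<open>z\<close> to the top.
  The extended curves cross, and the hypotheses leave only a crossing of \<open>\<gamma>\<close>
  with \<open>\<eta>\<close> or with the lower vertical axis.\<close>

lemma planar_crossing:
  fixes \<gamma> \<eta> :: "real \<Rightarrow> real \<times> real"
  assumes "path \<gamma>" "path \<eta>"
    and \<gamma>: "pathstart \<gamma> = a" "pathfinish \<gamma> = b" "0 < snd a" "0 < snd b"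
    and \<eta>: "pathstart \<eta> = 0" "pathfinish \<eta> = z"
    and below: "\<And>x. x \<in> path_image \<gamma> \<Longrightarrow> snd x < snd z"
    and left: "\<And>x. x \<in> path_image \<eta> \<Longrightarrow> snd x = snd a \<Longrightarrow> fst a < fst x"
    and right: "\<And>x. x \<in> path_image \<eta> \<Longrightarrow> snd x = snd b \<Longrightarrow> fst x < fst b"
  shows "path_image \<gamma> \<inter> path_image \<eta> \<noteq> {} \<or> (\<exists>x\<in>path_image \<gamma>. fst x = 0 \<and> snd x \<le> 0)"
proof -
  have "bounded (path_image \<gamma> \<union> path_image \<eta>)"
    using assms(1,2) by (simp add: bounded_path_image)
  then obtain r where r: "\<And>x. x \<in> path_image \<gamma> \<union> path_image \<eta> \<Longrightarrow> norm x \<le> r"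
    unfolding bounded_iff by blast
  have R: "\<bar>fst x\<bar> \<le> r \<and> \<bar>snd x\<bar> \<le> r" if "x \<in> path_image \<gamma> \<union> path_image \<eta>" for x
    using r[OF that] norm_fst_le[of "fst x" "snd x"] norm_snd_le[of "snd x" "fst x"] by simp
  have ab: "a \<in> path_image \<gamma>" "b \<in> path_image \<gamma>" using \<gamma> by auto
  have z: "z \<in> path_image \<eta>" using \<eta> by auto
  have r0: "0 \<le> r" using R[of a] ab by auto
  define f where "f = linepath (-r, snd a) a +++ (\<gamma> +++ linepath b (r, snd b))"
  define g where "g = linepath (0, -r) 0 +++ (\<eta> +++ linepath z (fst z, r))"
  have seg_a: "snd x = snd a \<and> -r \<le> fst x \<and> fst x \<le> fst a" if "x \<in> closed_segment (-r, snd a) a" for x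
  proof -
    have "snd x \<in> closed_segment (snd a) (snd a)" "fst x \<in> closed_segment (-r) (fst a)"
      using that closed_segment_linear_image[OF linear_snd, of "(-r, snd a)" a]
        closed_segment_linear_image[OF linear_fst, of "(-r, snd a)" a] by auto
    then show ?thesis using R[of a] ab by (auto simp: closed_segment_eq_real_ivl split: if_splits)
  qed
  have seg_b: "snd x = snd b \<and> fst b \<le> fst x \<and> fst x \<le> r" if "x \<in> closed_segment b (r, snd b)" for x
  proof -
    have "snd x \<in> closed_segment (snd b) (snd b)" "fst x \<in> closed_segment (fst b) r"
      using that closed_segment_linear_image[OF linear_snd, of b "(r, snd b)"]
        closed_segment_linear_image[OF linear_fst, of b "(r, snd b)"] by auto
    then show ?thesis using R[of b] ab by (auto simp: closed_segment_eq_real_ivl split: if_splits)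
  qed
  have seg_0: "fst x = 0 \<and> -r \<le> snd x \<and> snd x \<le> 0" if "x \<in> closed_segment (0, -r) 0" for x :: "real \<times> real"
  proof -
    have "snd x \<in> closed_segment (-r) 0" "fst x \<in> closed_segment 0 (0::real)"
      using that closed_segment_linear_image[OF linear_snd, of "(0::real, -r)" 0]
        closed_segment_linear_image[OF linear_fst, of "(0::real, -r)" 0] by auto
    then show ?thesis using r0 by (auto simp: closed_segment_eq_real_ivl split: if_splits)
  qed
  have seg_z: "fst x = fst z \<and> snd z \<le> snd x \<and> snd x \<le> r" if "x \<in> closed_segment z (fst z, r)" for x
  proof -
    have "snd x \<in> closed_segment (snd z) r" "fst x \<in> closed_segment (fst z) (fst z)"
      using that closed_segment_linear_image[OF linear_snd, of z "(fst z, r)"]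
        closed_segment_linear_image[OF linear_fst, of z "(fst z, r)"] by auto
    then show ?thesis using R[of z] z by (auto simp: closed_segment_eq_real_ivl split: if_splits)
  qed
  have f_img: "path_image f = closed_segment (-r, snd a) a \<union> (path_image \<gamma> \<union> closed_segment b (r, snd b))"
    unfolding f_def using \<gamma> by (simp add: path_image_join)
  have g_img: "path_image g = closed_segment (0, -r) 0 \<union> (path_image \<eta> \<union> closed_segment z (fst z, r))"
    unfolding g_def using \<eta> by (simp add: path_image_join)
  have boxI: "x \<in> cbox (-r, -r) (r, r)" if "\<bar>fst x\<bar> \<le> r" "\<bar>snd x\<bar> \<le> r" for x :: "real \<times> real"
    using that by (auto simp: cbox_Pair_eq mem_Times_iff)
  have "path_image f \<inter> path_image g \<noteq> {}"
  proof (rule fashoda_prod)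
    show "path f" "path g" unfolding f_def g_def using assms(1,2) \<gamma> \<eta> by auto
    show "path_image f \<subseteq> cbox (-r, -r) (r, r)"
      unfolding f_img using R[of a] R[of b] ab R by (fastforce intro!: boxI dest: seg_a seg_b)
    show "path_image g \<subseteq> cbox (-r, -r) (r, r)"
      unfolding g_img using R[of z] z R r0 by (fastforce intro!: boxI dest: seg_0 seg_z)
  qed (auto simp: f_def g_def)
  then obtain x where x: "x \<in> path_image f" "x \<in> path_image g" by blast
  \<comment> \<open>The horizontal extensions have heights strictly between 0 and
    \<open>snd z\<close>, so they miss both vertical ones; \<open>left\<close> and
    \<open>right\<close> keep them off \<open>\<eta>\<close>.\<close>
  have "x \<in> path_image \<gamma>" 
  proof (rule ccontr)
    assume "x \<notin> path_image \<gamma>"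
    then have xs: "(snd x = snd a \<and> fst x \<le> fst a) \<or> (snd x = snd b \<and> fst b \<le> fst x)"
      using x(1) seg_a[of x] seg_b[of x] unfolding f_img by blast
    from x(2) consider "x \<in> closed_segment (0, -r) 0" | "x \<in> path_image \<eta>" | "x \<in> closed_segment z (fst z, r)"
      unfolding g_img by blast
    then show False
    proof cases
      case 1
      with seg_0[of x] xs \<gamma> show False by auto
    next
      case 2
      with left[of x] right[of x] xs show False by auto
    next
      case 3
      with seg_z[of x] xs below[of a] below[of b] ab show False by auto
    qed
  qed
  with x(2) seg_0[of x] seg_z[of x] below[of x] show ?thesis
    unfolding g_img by force
qed

text \<open>The curve is the concatenation of the edges. The alternative \<open>a = b\<close>
  accommodates the constant curve of a one-vertex path.\<close>

lemma path_polyline: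
  assumes "is_path p"
  shows "\<exists>g. path g \<and> pathstart g = emb (hd p) \<and> pathfinish g = emb (last p) \<and>
    (\<forall>x\<in>path_image g. \<exists>a\<in>set p. \<exists>b\<in>set p. (a = b \<or> adj a b) \<and> x \<in> closed_segment (emb a) (emb b))"
  using assms
proof (induction p rule: induct_list012)
  case (2 x)
  show ?case by (rule exI[of _ "linepath (emb x) (emb x)"])
      (simp add: path_def pathstart_def pathfinish_def)
next
  case (3 x y zs)
  from 3(2)[OF 3(3)[unfolded is_path_Cons_Cons, THEN conjunct2]] obtain g where
    g: "path g" "pathstart g = emb y" "pathfinish g = emb (last (y # zs))"
    "\<forall>z\<in>path_image g. \<exists>a\<in>set (y # zs). \<exists>b\<in>set (y # zs). (a = b \<or> adj a b) \<and> z \<in> closed_segment (emb a) (emb b)"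
    by auto
  show ?case
  proof (intro exI[of _ "linepath (emb x) (emb y) +++ g"] conjI ballI)
    fix z assume "z \<in> path_image (linepath (emb x) (emb y) +++ g)"
    then consider "z \<in> closed_segment (emb x) (emb y)" | "z \<in> path_image g"
      using path_image_join_subset by fastforce
    then show "\<exists>a\<in>set (x # y # zs). \<exists>b\<in>set (x # y # zs).
        (a = b \<or> adj a b) \<and> z \<in> closed_segment (emb a) (emb b)"
    proof cases
      case 1
      then show ?thesis using 3(3) by auto
    next
      case 2
      then show ?thesis using g(4) by (meson list.set_intros(2))
    qed
  qed (use g in auto)
qed simp

text \<open>Turns a crossing of curves into a common lattice vertex. The projections of the edges
  are integer intervals of length at most 1, which share an endpoint when they meet. As each edge is
  constant in one coordinate, the coincidences in the two coordinates combine.\<close>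

lemma lattice_segments_meet:
  assumes "a = b \<or> adj a b" "c = d \<or> adj c d"
    and "x \<in> closed_segment (emb a) (emb b)" "x \<in> closed_segment (emb c) (emb d)"
  shows "{a, b} \<inter> {c, d} \<noteq> {}"
proof -
  have proj: "fst x \<in> closed_segment (real_of_int (fst p)) (real_of_int (fst q))"
    "snd x \<in> closed_segment (real_of_int (snd p)) (real_of_int (snd q))"
    if "x \<in> closed_segment (emb p) (emb q)" for p q
    using that closed_segment_linear_image[OF linear_fst, of "emb p" "emb q"]
      closed_segment_linear_image[OF linear_snd, of "emb p" "emb q"] by (auto simp: emb_def)
  have overlap: "min i j \<le> max k l" if "r \<in> closed_segment (real_of_int i) (real_of_int j)"
    "r \<in> closed_segment (real_of_int k) (real_of_int l)" for r i j k l
    using that by (auto simp: closed_segment_eq_real_ivl split: if_splits)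
  obtain a1 a2 b1 b2 c1 c2 d1 d2 where eqs: "a = (a1, a2)" "b = (b1, b2)" "c = (c1, c2)" "d = (d1, d2)"
    by (metis surj_pair)
  have near: "\<bar>a1 - b1\<bar> + \<bar>a2 - b2\<bar> \<le> 1" "\<bar>c1 - d1\<bar> + \<bar>c2 - d2\<bar> \<le> 1"
    using assms(1,2) by (auto simp: adj_def eqs)
  have overlaps: "min a1 b1 \<le> max c1 d1" "min c1 d1 \<le> max a1 b1" "min a2 b2 \<le> max c2 d2" "min c2 d2 \<le> max a2 b2"
    using overlap[OF proj(1)[OF assms(3)] proj(1)[OF assms(4)]]
      overlap[OF proj(1)[OF assms(4)] proj(1)[OF assms(3)]]
      overlap[OF proj(2)[OF assms(3)] proj(2)[OF assms(4)]]
      overlap[OF proj(2)[OF assms(4)] proj(2)[OF assms(3)]]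
    by (simp_all add: eqs)
  have overlap_1d: "i = k \<or> i = l \<or> j = k \<or> j = l"
    if "\<bar>j - i\<bar> \<le> 1" "\<bar>l - k\<bar> \<le> 1" "min i j \<le> max k l" "min k l \<le> max i j" for i j k l :: int
    using that by linarith
  have "b1 = a1 \<or> b2 = a2" "d1 = c1 \<or> d2 = c2" "\<bar>b1 - a1\<bar> \<le> 1" "\<bar>b2 - a2\<bar> \<le> 1"
    "\<bar>d1 - c1\<bar> \<le> 1" "\<bar>d2 - c2\<bar> \<le> 1"
    using near by linarith+
  then have "(a1 = c1 \<and> a2 = c2) \<or> (a1 = d1 \<and> a2 = d2) \<or> (b1 = c1 \<and> b2 = c2) \<or> (b1 = d1 \<and> b2 = d2)"
    using overlap_1d[OF _ _ overlaps(1,2)] overlap_1d[OF _ _ overlaps(3,4)] overlaps by auto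
  then show ?thesis by (auto simp: eqs)
qed

section \<open>Extinction in wide cones\<close>

text \<open>Coordinates in which the direction \<open>\<theta>\<close> is vertical.\<close>

definition rot :: "real \<Rightarrow> plane \<Rightarrow> plane" where
  "rot \<theta> x = ((sin \<theta>, - cos \<theta>) \<bullet> x, unit_vec \<theta> \<bullet> x)"

lemma linear_rot: "linear (rot \<theta>)"
  unfolding rot_def by (intro linearI) (auto simp: inner_add_right inner_scaleR_right)

lemma norm_rot [simp]: "norm (rot \<theta> x) = norm x"
proof -
  \<comment> \<open>The Brahmagupta-Fibonacci identity, applied with
    \<open>a\<^sup>2 + b\<^sup>2 = 1\<close>.\<close>
  have "(a * p - b * q)\<^sup>2 + (b * p + a * q)\<^sup>2 = (a\<^sup>2 + b\<^sup>2) * (p\<^sup>2 + q\<^sup>2)" for a b p q :: real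
    by (simp add: power2_eq_square algebra_simps)
  from this[of "sin \<theta>" "fst x" "cos \<theta>" "snd x"]
  show ?thesis by (cases x) (simp add: rot_def unit_vec_def norm_Pair)
qed

lemma rot_eq_iff [simp]: "rot \<theta> x = rot \<theta> y \<longleftrightarrow> x = y"
proof
  assume "rot \<theta> x = rot \<theta> y"
  then have "rot \<theta> (x - y) = 0" by (simp add: linear_diff[OF linear_rot])
  then show "x = y" using norm_rot[of \<theta> "x - y"] by simp
qed simp

lemma rot_surj: "\<exists>x. rot \<theta> x = p"
proof
  have "rot \<theta> (fst p *\<^sub>R (sin \<theta>, - cos \<theta>) + snd p *\<^sub>R unit_vec \<theta>)
      = (((sin \<theta>)\<^sup>2 + (cos \<theta>)\<^sup>2) * fst p, ((sin \<theta>)\<^sup>2 + (cos \<theta>)\<^sup>2) * snd p)"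
    by (simp add: rot_def unit_vec_def power2_eq_square distrib_right)
      (simp add: algebra_simps)
  then show "rot \<theta> (fst p *\<^sub>R (sin \<theta>, - cos \<theta>) + snd p *\<^sub>R unit_vec \<theta>) = p" by simp
qed

text \<open>A site near the point with rotated coordinates
  \<open>(n * \<sigma>, n * \<kappa> / 2)\<close> works for large \<open>n\<close>: there
  \<open>B\<close> grows linearly in \<open>n\<close>, the height is about half of what is allowed,
  and the sign \<open>\<sigma>\<close> selects the side.\<close>

lemma exists_site_large_above:
  fixes B :: "site \<Rightarrow> real"
  assumes "0 < c" "0 < \<kappa>" "\<kappa> \<le> 1" "\<bar>\<sigma>\<bar> = 1"
    and asymp: "\<And>\<epsilon>. 0 < \<epsilon> \<Longrightarrow> \<exists>N. \<forall>y. N \<le> norm (emb y) \<longrightarrow>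
       \<bar>B y - c * snd (rot \<theta> (emb y))\<bar> \<le> \<epsilon> * norm (emb y)"
  shows "\<exists>y. K < B y \<and> 0 < snd (rot \<theta> (emb y)) \<and> snd (rot \<theta> (emb y)) < \<kappa> * norm (emb y) \<and>
    0 < \<sigma> * fst (rot \<theta> (emb y))"
proof -
  \<comment> \<open>The norm will be at most \<open>2 * n + 4\<close>, so the error is at most about
    a quarter of the main term \<open>c * n * \<kappa> / 2\<close>.\<close>
  define \<epsilon> where "\<epsilon> = c * \<kappa> / 16"
  have "0 < \<epsilon>" using assms by (simp add: \<epsilon>_def)
  then obtain N where N: "\<bar>B y - c * snd (rot \<theta> (emb y))\<bar> \<le> \<epsilon> * norm (emb y)" if "N \<le> norm (emb y)" for y
    using asymp by blast
  \<comment> \<open>In turn, the thresholds bring the norm beyond \<open>N\<close> despite rounding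
    by 2, fix the sign of the horizontal coordinate, absorb the rounding of the height, and push the
    lower bound for \<open>B\<close> past \<open>K\<close>.\<close>
  obtain n where n0: "max (max (N + 2) 3) (max (8 / \<kappa>) ((K + 3 * c) * 8 / (3 * c * \<kappa>))) < n"
    using gt_ex by blast
  have n: "N + 2 < n" "3 < n" "8 < n * \<kappa>" "(K + 3 * c) * 8 < n * (3 * c * \<kappa>)"
    using n0 assms(1,2) by (simp_all only: max_less_iff_conj divide_less_eq zero_less_mult_iff) auto
  obtain x where x: "rot \<theta> x = (n * \<sigma>, n * \<kappa> / 2)" using rot_surj by blast
  obtain y where y: "norm (emb y - x) \<le> 2" using emb_near by blast
  define s t where "s = fst (rot \<theta> (emb y))" and "t = snd (rot \<theta> (emb y))"
  have diff: "rot \<theta> (emb y - x) = (s - n * \<sigma>, t - n * \<kappa> / 2)"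
    using x by (simp add: s_def t_def linear_diff[OF linear_rot] prod_eq_iff)
  have st: "\<bar>s - n * \<sigma>\<bar> \<le> 2" "\<bar>t - n * \<kappa> / 2\<bar> \<le> 2"
    using y norm_fst_le[of "s - n * \<sigma>" "t - n * \<kappa> / 2"] norm_snd_le[of "t - n * \<kappa> / 2" "s - n * \<sigma>"]
    by (simp_all flip: diff)
  have \<sigma>: "\<sigma> = 1 \<or> \<sigma> = -1" using assms(4) by linarith
  have y_lower: "n - 2 \<le> norm (emb y)"
    using norm_fst_le[of s t] st(1) \<sigma> n(2) norm_rot[of \<theta> "emb y"] unfolding s_def t_def
    by (auto simp: abs_le_iff)
  have nk: "n * \<kappa> \<le> n" using assms(3) n(2) by simp
  have "norm (emb y) \<le> \<bar>s\<bar> + \<bar>t\<bar>"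
    using norm_Pair_le[of s t] norm_rot[of \<theta> "emb y"] by (simp add: s_def t_def)
  moreover have "\<bar>s\<bar> \<le> n + 2" using st(1) \<sigma> n(2) by auto
  moreover have "\<bar>t\<bar> \<le> n / 2 + 2" using st(2) nk n(2,3) by linarith
  ultimately have y_upper: "norm (emb y) \<le> 2 * n + 4" using n(2) by linarith
  define P Q where "P = n * \<kappa> * c" and "Q = c * \<kappa>"
  have "\<bar>B y - c * t\<bar> \<le> \<epsilon> * norm (emb y)" unfolding t_def using N y_lower n(1) by simp
  then have "c * t - \<epsilon> * norm (emb y) \<le> B y" by linarith
  moreover have "\<epsilon> * norm (emb y) \<le> \<epsilon> * (2 * n + 4)" using y_upper \<open>0 < \<epsilon>\<close> by simp
  moreover have "\<epsilon> * (2 * n + 4) = P / 8 + Q / 4" by (simp add: \<epsilon>_def P_def Q_def field_simps)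
  moreover have "c * (n * \<kappa> / 2 - 2) \<le> c * t" using st(2) assms(1) by (simp add: abs_le_iff)
  moreover have "c * (n * \<kappa> / 2 - 2) = P / 2 - 2 * c" by (simp add: P_def field_simps)
  moreover have "Q \<le> c" using assms(1,3) by (simp add: Q_def)
  moreover have "(K + 3 * c) * 8 < 3 * P" using n(4) by (simp add: P_def mult_ac)
  ultimately have "K < B y" using assms(1) by argo
  moreover have "\<kappa> * (n - 2) \<le> \<kappa> * norm (emb y)" using y_lower assms(2) by simp
  then have "t < \<kappa> * norm (emb y)"
    using st(2) n(3) assms(3) by (simp add: abs_le_iff algebra_simps)
  moreover have "0 < t" using st(2) n(3) by (simp add: abs_le_iff)
  moreover have "0 < \<sigma> * s" using st(1) \<sigma> n(2) by (auto simp: abs_le_iff)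
  ultimately show ?thesis unfolding s_def t_def by blast
qed

text \<open>At height \<open>t\<close> in this half-strip the norm is at most \<open>3 - t\<close>.
  With error rate \<open>c\<close>, far sites satisfy B \<le> c * t + c * (3 - t) = 3 * c, and
  finitely many sites remain. The half-width 1 suits edges that hit the ray: their endpoints lie
  within distance 1 of it.\<close>

lemma bounded_above_near_negative_ray:
  fixes B :: "site \<Rightarrow> real"
  assumes "0 < c"
    and asymp: "\<And>\<epsilon>. 0 < \<epsilon> \<Longrightarrow> \<exists>N. \<forall>y. N \<le> norm (emb y) \<longrightarrow>
       \<bar>B y - c * snd (rot \<theta> (emb y))\<bar> \<le> \<epsilon> * norm (emb y)"
  shows "\<exists>K. \<forall>q. \<bar>fst (rot \<theta> (emb q))\<bar> \<le> 1 \<and> snd (rot \<theta> (emb q)) \<le> 1 \<longrightarrow> B q \<le> K"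
proof -
  obtain N where N: "\<bar>B y - c * snd (rot \<theta> (emb y))\<bar> \<le> c * norm (emb y)" if "N \<le> norm (emb y)" for y
    using asymp[OF assms(1)] by blast
  define K where "K = Max (insert (3 * c) (B ` {q. norm (emb q) \<le> N}))"
  have fin: "finite (insert (3 * c) (B ` {q. norm (emb q) \<le> N}))" by (simp add: finite_norm_emb_le)
  have "B q \<le> K" if q: "\<bar>fst (rot \<theta> (emb q))\<bar> \<le> 1" "snd (rot \<theta> (emb q)) \<le> 1" for q
  proof (cases "norm (emb q) \<le> N")
    case True
    then show ?thesis unfolding K_def by (intro Max_ge[OF fin]) auto
  next
    case False
    define s t where "s = fst (rot \<theta> (emb q))" and "t = snd (rot \<theta> (emb q))"
    have "norm (emb q) \<le> \<bar>s\<bar> + \<bar>t\<bar>"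
      using norm_Pair_le[of s t] norm_rot[of \<theta> "emb q"] by (simp add: s_def t_def)
    then have "norm (emb q) \<le> 3 - t" using q by (auto simp: s_def t_def)
    then have "c * norm (emb q) \<le> c * (3 - t)" using assms(1) by simp
    moreover have "\<bar>B q - c * t\<bar> \<le> c * norm (emb q)" unfolding t_def using N False by simp
    ultimately have "B q \<le> 3 * c" by (simp add: algebra_simps)
    also have "\<dots> \<le> K" unfolding K_def using fin by (intro Max_ge) auto
    finally show ?thesis .
  qed
  then show ?thesis by blast
qed

lemma finite_occupied2_wide_cone:
  assumes nonneg: "nonneg_weights w" and v: "v \<in> geodesics_from_origin w"
    and lin: "busemann_asymp_linear A w v \<theta>" and \<alpha>: "pi / 2 < \<alpha>" "\<alpha> \<le> pi"
  shows "finite (occupied2 w {z. emb z \<in> cone \<theta> \<alpha> - {0}} {0})"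
proof (rule ccontr)
  define I where "I = {z. emb z \<in> cone \<theta> \<alpha> - {0}}"
  assume "\<not> finite (occupied2 w {z. emb z \<in> cone \<theta> \<alpha> - {0}} {0})"
  then have inf: "infinite (occupied2 w I {0})" by (simp add: I_def)
  define T where "T = passage_time w"
  define B where "B = busemann w v 0"
  define \<kappa> where "\<kappa> = - cos \<alpha>"
  have "0 < cos (pi - \<alpha>)" using \<alpha> by (intro cos_gt_zero_pi) auto
  then have \<kappa>: "0 < \<kappa>" "\<kappa> \<le> 1" by (simp_all add: \<kappa>_def cos_diff)
  define s t where "s y = fst (rot \<theta> (emb y))" and "t y = snd (rot \<theta> (emb y))" for y
  have I: "y \<in> I \<longleftrightarrow> y \<noteq> 0 \<and> t y \<le> \<kappa> * norm (emb y)" for y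
    using \<alpha> by (auto simp: I_def mem_cone_iff t_def rot_def \<kappa>_def)
  obtain c where c: "0 < c"
    and asymp: "\<And>\<epsilon>. 0 < \<epsilon> \<Longrightarrow> \<exists>N. \<forall>y. N \<le> norm (emb y) \<longrightarrow>
       \<bar>B y - c * snd (rot \<theta> (emb y))\<bar> \<le> \<epsilon> * norm (emb y)"
    unfolding B_def rot_def snd_conv using busemann_asymp_linearD[OF lin] by blast
  obtain K0 where K0: "\<bar>s q\<bar> \<le> 1 \<Longrightarrow> t q \<le> 1 \<Longrightarrow> B q \<le> K0" for q
    using bounded_above_near_negative_ray[OF c asymp] unfolding s_def t_def by blast
  \<comment> \<open>\<open>K0 \<le> K\<close> will keep the fast paths off the ray, and
    \<open>0 \<le> K\<close> will keep them off the type 2 sites.\<close>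
  define K where "K = max K0 0"
  obtain y1 where y1: "K < B y1" "0 < t y1" "t y1 < \<kappa> * norm (emb y1)" "s y1 < 0"
    using exists_site_large_above[OF c \<kappa> _ asymp, of "-1" K] unfolding s_def t_def by auto
  obtain y2 where y2: "K < B y2" "0 < t y2" "t y2 < \<kappa> * norm (emb y2)" "0 < s y2"
    using exists_site_large_above[OF c \<kappa> _ asymp, of 1 K] unfolding s_def t_def by auto
  have "y1 \<in> I" "y2 \<in> I" using y1 y2 by (auto simp: I t_def rot_def)
  have ev: "eventually (\<lambda>k. K < T 0 (v k) - T y (v k)) sequentially" if "K < B y" for y
    using busemann_tendsto[OF nonneg v, of y] that unfolding B_def T_def by (rule order_tendstoD)
  from eventually_conj[OF ev[OF y1(1)] ev[OF y2(1)]] obtain k where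
    k: "K < T 0 (v k) - T y1 (v k)" "K < T 0 (v k) - T y2 (v k)"
    unfolding eventually_sequentially by blast
  obtain p1 where p1: "path_between y1 (v k) p1" "path_time w p1 < T 0 (v k) - K"
    using passage_time_less_obtain[of w y1 "v k" "T 0 (v k) - K"] k(1) unfolding T_def by auto
  obtain p2 where p2: "path_between y2 (v k) p2" "path_time w p2 < T 0 (v k) - K"
    using passage_time_less_obtain[of w y2 "v k" "T 0 (v k) - K"] k(2) unfolding T_def by auto
  obtain r where r: "\<And>q. q \<in> set p1 \<union> set p2 \<Longrightarrow> t q < r"
  proof
    show "t q < Max (t ` (set p1 \<union> set p2)) + 1" if "q \<in> set p1 \<union> set p2" for q
    proof -
      have "t q \<le> Max (t ` (set p1 \<union> set p2))" using that by (intro Max_ge) auto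
      then show ?thesis by linarith
    qed
  qed
  \<comment> \<open>A type 2 site this far out is higher than all of \<open>p1\<close> and
    \<open>p2\<close>, because its height is at least \<open>\<kappa>\<close> times its
    norm.\<close>
  have "\<not> occupied2 w I {0} \<subseteq> {z. norm (emb z) \<le> r / \<kappa>}"
    using inf finite_subset[OF _ finite_norm_emb_le] by blast
  then obtain z where z: "z \<in> occupied2 w I {0}" "r / \<kappa> < norm (emb z)"
    unfolding subset_iff mem_Collect_eq linorder_not_le[symmetric] by blast
  have "ereal (T 0 z) < set_passage_time w I z"
    using z(1) by (simp add: occupied2_def set_passage_time_def T_def)
  \<comment> \<open>The gap leaves room for a path \<open>p0\<close> to \<open>z\<close> that is
    still faster than any start in \<open>I\<close>.\<close>
  then obtain r' where r': "ereal (T 0 z) < ereal r'" "ereal r' < set_passage_time w I z"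
    using ereal_dense2 by blast
  then obtain p0 where p0: "path_between 0 z p0" "path_time w p0 < r'"
    using passage_time_less_obtain[of w 0 z r'] unfolding T_def by auto
  have r'_less: "r' < T y z" if "y \<in> I" for y
    using r'(2) that unfolding set_passage_time_def T_def by (auto dest: less_INF_D)
  \<comment> \<open>Otherwise \<open>y\<close> would reach \<open>z\<close> through \<open>p\<close>
    in time less than \<open>r'\<close>.\<close>
  have faster: "T 0 p < T y p" if "p \<in> set p0" "y \<in> I" for p y
    using passage_time_via[OF nonneg p0(1) that(1)] passage_time_triangle[OF nonneg, of y z p]
      r'_less[OF that(2)] p0(2) unfolding T_def by linarith
  \<comment> \<open>A site of \<open>I\<close> reaches itself in time 0, so by \<open>faster\<close>
    no vertex of \<open>p0\<close> lies in \<open>I\<close>.\<close>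
  have sector: "\<kappa> * norm (emb p) \<le> t p" if "p \<in> set p0" for p
  proof (cases "p = 0")
    case False
    have "p \<notin> I" using faster[OF that] passage_time_self[OF nonneg] passage_time_nonneg[OF nonneg]
      unfolding T_def by (metis linorder_not_le)
    then show ?thesis using False by (simp add: I)
  qed (simp add: t_def rot_def)
  obtain g0 where g0: "path g0" "pathstart g0 = 0" "pathfinish g0 = emb z"
    "\<And>x. x \<in> path_image g0 \<Longrightarrow> \<exists>a\<in>set p0. \<exists>b\<in>set p0. (a = b \<or> adj a b) \<and> x \<in> closed_segment (emb a) (emb b)"
    using path_polyline[of p0] p0(1) unfolding path_between_def by auto
  obtain g1 where g1: "path g1" "pathstart g1 = emb y1" "pathfinish g1 = emb (v k)"
    "\<And>x. x \<in> path_image g1 \<Longrightarrow> \<exists>a\<in>set p1. \<exists>b\<in>set p1. (a = b \<or> adj a b) \<and> x \<in> closed_segment (emb a) (emb b)"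
    using path_polyline[of p1] p1(1) unfolding path_between_def by auto
  obtain g2 where g2: "path g2" "pathstart g2 = emb y2" "pathfinish g2 = emb (v k)"
    "\<And>x. x \<in> path_image g2 \<Longrightarrow> \<exists>a\<in>set p2. \<exists>b\<in>set p2. (a = b \<or> adj a b) \<and> x \<in> closed_segment (emb a) (emb b)"
    using path_polyline[of p2] p2(1) unfolding path_between_def by auto
  define \<gamma> where "\<gamma> = g1 +++ reversepath g2"
  have \<gamma>_img: "path_image \<gamma> = path_image g1 \<union> path_image g2"
    unfolding \<gamma>_def using g1 g2 by (simp add: path_image_join)
  have \<gamma>: "\<exists>p\<in>{p1, p2}. \<exists>a\<in>set p. \<exists>b\<in>set p. (a = b \<or> adj a b) \<and> x \<in> closed_segment (emb a) (emb b)"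
    if "x \<in> path_image \<gamma>" for x
    using that g1(4)[of x] g2(4)[of x] unfolding \<gamma>_img by blast
  \<comment> \<open>Convexity carries the bound from the vertices of \<open>p0\<close> to its
    edges.\<close>
  have convex: "convex {x. \<kappa> * norm x \<le> snd (rot \<theta> x)}"
  proof (rule convexI)
    fix x y and \<mu> \<delta> :: real
    assume *: "x \<in> {x. \<kappa> * norm x \<le> snd (rot \<theta> x)}" "y \<in> {x. \<kappa> * norm x \<le> snd (rot \<theta> x)}"
      "0 \<le> \<mu>" "0 \<le> \<delta>"
    have "\<kappa> * norm (\<mu> *\<^sub>R x + \<delta> *\<^sub>R y) \<le> \<kappa> * (\<mu> * norm x + \<delta> * norm y)"
      using \<kappa>(1) *(3,4) norm_triangle_ineq[of "\<mu> *\<^sub>R x" "\<delta> *\<^sub>R y"] by (intro mult_left_mono) auto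
    also have "\<dots> = \<mu> * (\<kappa> * norm x) + \<delta> * (\<kappa> * norm y)" by (simp add: algebra_simps)
    also have "\<dots> \<le> \<mu> * snd (rot \<theta> x) + \<delta> * snd (rot \<theta> y)"
      using * by (intro add_mono mult_left_mono) auto
    also have "\<dots> = snd (rot \<theta> (\<mu> *\<^sub>R x + \<delta> *\<^sub>R y))"
      by (simp add: linear_add[OF linear_rot] linear_cmul[OF linear_rot])
    finally show "\<mu> *\<^sub>R x + \<delta> *\<^sub>R y \<in> {x. \<kappa> * norm x \<le> snd (rot \<theta> x)}" by simp
  qed
  have g0_sector: "\<kappa> * norm x \<le> snd (rot \<theta> x)" if x: "x \<in> path_image g0" for x
  proof -
    obtain a b where ab: "a \<in> set p0" "b \<in> set p0" "x \<in> closed_segment (emb a) (emb b)"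
      using g0(4)[OF x] by blast
    then show ?thesis
      using closed_segment_subset[OF _ _ convex, of "emb a" "emb b"] sector unfolding t_def by blast
  qed
  \<comment> \<open>At equal heights a smaller norm means a smaller horizontal coordinate. Hence
    \<open>y1\<close> lies to the left and \<open>y2\<close> to the right of \<open>g0\<close> at
    their heights.\<close>
  have narrow: "\<bar>fst (rot \<theta> x)\<bar> < \<bar>s y\<bar>"
    if x: "x \<in> path_image g0" "snd (rot \<theta> x) = t y" and y: "0 < t y" "t y < \<kappa> * norm (emb y)" for x y
  proof -
    have "\<kappa> * norm x < \<kappa> * norm (emb y)" using g0_sector[OF x(1)] x(2) y(2) by simp
    then have "norm (rot \<theta> x) < norm (rot \<theta> (emb y))" using \<kappa>(1) by simp
    then have "(fst (rot \<theta> x))\<^sup>2 + (t y)\<^sup>2 < (s y)\<^sup>2 + (t y)\<^sup>2"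
      using x(2) unfolding norm_prod_def s_def t_def by simp
    then show ?thesis using abs_le_square_iff[of "s y" "fst (rot \<theta> x)"] by linarith
  qed
  have "path_image (rot \<theta> \<circ> \<gamma>) \<inter> path_image (rot \<theta> \<circ> g0) \<noteq> {} \<or>
      (\<exists>x\<in>path_image (rot \<theta> \<circ> \<gamma>). fst x = 0 \<and> snd x \<le> 0)"
  proof (rule planar_crossing)
    have "continuous_on S (rot \<theta>)" for S
      using linear_rot by (simp add: linear_continuous_on linear_conv_bounded_linear)
    then show "path (rot \<theta> \<circ> \<gamma>)" "path (rot \<theta> \<circ> g0)"
      unfolding \<gamma>_def using g0 g1 g2 by (auto intro!: path_continuous_image)
    show "pathstart (rot \<theta> \<circ> \<gamma>) = rot \<theta> (emb y1)" "pathfinish (rot \<theta> \<circ> \<gamma>) = rot \<theta> (emb y2)"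
      "pathstart (rot \<theta> \<circ> g0) = 0" "pathfinish (rot \<theta> \<circ> g0) = rot \<theta> (emb z)"
      using g0 g1 g2 linear_0[OF linear_rot] by (simp_all add: \<gamma>_def pathstart_compose pathfinish_compose)
    show "0 < snd (rot \<theta> (emb y1))" "0 < snd (rot \<theta> (emb y2))" using y1 y2 by (simp_all add: t_def)
  next
    fix x assume "x \<in> path_image (rot \<theta> \<circ> \<gamma>)"
    then obtain x' where x': "x' \<in> path_image \<gamma>" "x = rot \<theta> x'" by (auto simp: path_image_compose)
    from \<gamma>[OF x'(1)] obtain a b where ab: "a \<in> set p1 \<union> set p2" "b \<in> set p1 \<union> set p2"
      "x' \<in> closed_segment (emb a) (emb b)" by blast
    have "convex {x. unit_vec \<theta> \<bullet> x < r}" by (rule convex_halfspace_lt)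
    then have "x' \<in> {x. unit_vec \<theta> \<bullet> x < r}"
      using closed_segment_subset[of "emb a" "{x. unit_vec \<theta> \<bullet> x < r}" "emb b"] r[OF ab(1)] r[OF ab(2)] ab(3)
      by (auto simp: t_def rot_def)
    then have "snd x < r" by (simp add: x' rot_def)
    also have "r < \<kappa> * norm (emb z)" using z(2) \<kappa>(1) by (simp add: field_simps)
    also have "\<dots> \<le> snd (rot \<theta> (emb z))" using g0_sector[of "emb z"] g0(3) pathfinish_in_path_image by metis
    finally show "snd x < snd (rot \<theta> (emb z))" .
  next
    fix x assume "x \<in> path_image (rot \<theta> \<circ> g0)" "snd x = snd (rot \<theta> (emb y1))"
    then show "fst (rot \<theta> (emb y1)) < fst x"
      using narrow[OF _ _ y1(2,3)] y1(4) by (force simp: path_image_compose s_def t_def)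
  next
    fix x assume "x \<in> path_image (rot \<theta> \<circ> g0)" "snd x = snd (rot \<theta> (emb y2))"
    then show "fst x < fst (rot \<theta> (emb y2))"
      using narrow[OF _ _ y2(2,3)] y2(4) by (force simp: path_image_compose s_def t_def)
  qed
  then consider x where "x \<in> path_image \<gamma>" "x \<in> path_image g0"
    | x where "x \<in> path_image \<gamma>" "fst (rot \<theta> x) = 0" "snd (rot \<theta> x) \<le> 0"
    by (auto simp: path_image_compose)
  then show False
  proof cases
    \<comment> \<open>The origin reaches the common vertex \<open>q\<close> before \<open>y\<close>
      does, so \<open>p\<close> takes longer than T(0, v k), against
      \<open>0 \<le> K\<close>.\<close>
    case (1 x)
    from \<gamma>[OF 1(1)] obtain p a b where ab: "p \<in> {p1, p2}" "a \<in> set p" "b \<in> set p" "a = b \<or> adj a b"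
      "x \<in> closed_segment (emb a) (emb b)" by blast
    from g0(4)[OF 1(2)] obtain c d where cd: "c \<in> set p0" "d \<in> set p0" "c = d \<or> adj c d"
      "x \<in> closed_segment (emb c) (emb d)" by blast
    have "{a, b} \<inter> {c, d} \<noteq> {}" using lattice_segments_meet ab cd by blast
    then obtain q where q: "q \<in> set p" "q \<in> set p0" using ab cd by blast
    obtain y where y: "y \<in> I" "path_between y (v k) p" "path_time w p < T 0 (v k) - K"
      using ab(1) p1 p2 \<open>y1 \<in> I\<close> \<open>y2 \<in> I\<close> by blast
    have "T y q + T q (v k) \<le> path_time w p"
      unfolding T_def by (rule passage_time_via[OF nonneg y(2) q(1)])
    moreover have "T 0 q < T y q" by (rule faster[OF q(2) y(1)])
    moreover have "T 0 (v k) \<le> T 0 q + T q (v k)"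
      unfolding T_def by (rule passage_time_triangle[OF nonneg])
    ultimately show False using y(3) unfolding K_def by linarith
  next
    \<comment> \<open>The edge of \<open>p\<close> that hits the ray has an endpoint
      \<open>a\<close> with \<open>B a \<le> K\<close>, so \<open>p\<close> needs at least T(0, v k)
      - K.\<close>
    case (2 x)
    from \<gamma>[OF 2(1)] obtain p a b where ab: "p \<in> {p1, p2}" "a \<in> set p" "a = b \<or> adj a b"
      "x \<in> closed_segment (emb a) (emb b)" by blast
    obtain y where y: "y \<in> I" "path_between y (v k) p" "path_time w p < T 0 (v k) - K"
      using ab(1) p1 p2 \<open>y1 \<in> I\<close> \<open>y2 \<in> I\<close> by blast
    have "norm (emb a - emb b) \<le> \<bar>fst (emb a - emb b)\<bar> + \<bar>snd (emb a - emb b)\<bar>"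
      using norm_Pair_le[of "fst (emb a - emb b)" "snd (emb a - emb b)"]
      by (simp only: prod.collapse real_norm_def)
    also have "\<dots> \<le> 1"
    proof -
      have "\<bar>fst a - fst b\<bar> + \<bar>snd a - snd b\<bar> \<le> 1" using ab(3) by (auto simp: adj_def)
      then have "real_of_int (\<bar>fst a - fst b\<bar> + \<bar>snd a - snd b\<bar>) \<le> 1" by linarith
      then show ?thesis by (simp add: emb_def)
    qed
    finally have "norm (emb a - x) \<le> 1"
      using segment_bound1[of x "emb a" "emb b"] ab(4) by (simp add: norm_minus_commute)
    then have "norm (rot \<theta> (emb a) - rot \<theta> x) \<le> 1" by (simp flip: linear_diff[OF linear_rot])
    moreover have "rot \<theta> (emb a) - rot \<theta> x = (s a, t a - snd (rot \<theta> x))"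
      using 2(2) by (simp add: s_def t_def prod_eq_iff)
    ultimately have "\<bar>s a\<bar> \<le> 1" "\<bar>t a - snd (rot \<theta> x)\<bar> \<le> 1"
      using norm_fst_le[of "s a" "t a - snd (rot \<theta> x)"] norm_snd_le[of "t a - snd (rot \<theta> x)" "s a"]
      by simp_all
    then have "B a \<le> K" using K0[of a] 2(3) unfolding K_def by linarith
    moreover have "T 0 (v k) - T a (v k) \<le> B a"
      unfolding T_def B_def by (rule le_busemann[OF nonneg v])
    moreover have "T y a + T a (v k) \<le> path_time w p"
      unfolding T_def by (rule passage_time_via[OF nonneg y(2) ab(2)])
    moreover have "0 \<le> T y a" unfolding T_def by (rule passage_time_nonneg[OF nonneg])
    ultimately show False using y(3) by linarith
  qed
qed

section \<open>Measurability and translation invariance\<close>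

lemma countable_edges: "countable edges"
proof (rule countable_subset)
  show "edges \<subseteq> (\<lambda>(x, y). {x, y}) ` UNIV" unfolding edges_def by auto
qed simp

lemma edges_nonempty: "edges \<noteq> {}"
  using edges_memI[of "(0, 0)" "(1, 0)"] by (auto simp: adj_def)

lemma path_edge: "is_path p \<Longrightarrow> i < length p - 1 \<Longrightarrow> {p ! i, p ! Suc i} \<in> edges"
  by (intro edges_memI) (simp add: is_path_def)

text \<open>There are countably many paths, and each path time reads finitely many coordinates, all
  in \<open>edges\<close>.\<close>

lemma borel_measurable_passage_time:
  "(\<lambda>w. passage_time w x y) \<in> borel_measurable (PiM edges (\<lambda>_. borel))"
  unfolding passage_time_def path_time_def
proof (rule borel_measurable_cINF_real)
  fix p assume "p \<in> {p. path_between x y p}"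
  then have "is_path p" by (simp add: path_between_def)
  show "(\<lambda>w. \<Sum>i<length p - 1. w {p ! i, p ! Suc i} :: real) \<in> borel_measurable (PiM edges (\<lambda>_. borel))"
  proof (rule borel_measurable_sum)
    fix i assume "i \<in> {..<length p - 1}"
    then have "{p ! i, p ! Suc i} \<in> edges" using path_edge[OF \<open>is_path p\<close>] by simp
    then show "(\<lambda>w. w {p ! i, p ! Suc i} :: real) \<in> borel_measurable (PiM edges (\<lambda>_. borel))"
      by (rule measurable_component_singleton)
  qed
qed simp

lemma borel_measurable_set_passage_time:
  "(\<lambda>w. set_passage_time w I z) \<in> borel_measurable (PiM edges (\<lambda>_. borel))"
  unfolding set_passage_time_def
  by (intro borel_measurable_INF borel_measurable_ereal borel_measurable_passage_time) simp

text \<open>Expresses infinitude by countable quantifiers, which makes survival measurable.\<close>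

lemma infinite_sites_iff:
  fixes S :: "site set"
  shows "infinite S \<longleftrightarrow> (\<forall>n::nat. \<exists>z. n < norm (emb z) \<and> z \<in> S)"
proof
  assume "infinite S"
  then have "\<not> S \<subseteq> {z. norm (emb z) \<le> real n}" for n
    using finite_subset[OF _ finite_norm_emb_le] by blast
  then show "\<forall>n::nat. \<exists>z. n < norm (emb z) \<and> z \<in> S"
    unfolding subset_iff mem_Collect_eq linorder_not_le[symmetric] by blast
next
  assume *: "\<forall>n::nat. \<exists>z. n < norm (emb z) \<and> z \<in> S"
  show "infinite S"
  proof
    assume "finite S"
    then have fin: "finite ((\<lambda>z. norm (emb z)) ` S)" by simp
    obtain n :: nat where "Max ((\<lambda>z. norm (emb z)) ` S) \<le> n" using real_arch_simple by blast
    moreover obtain z where z: "n < norm (emb z)" "z \<in> S" using * by blast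
    moreover have "norm (emb z) \<le> Max ((\<lambda>z. norm (emb z)) ` S)"
      using z(2) by (intro Max_ge[OF fin]) auto
    ultimately show False by linarith
  qed
qed

lemma sets_type2_survives:
  "{w \<in> space (PiM edges (\<lambda>_. borel)). type2_survives w I1 I2} \<in> sets (PiM edges (\<lambda>_. borel))"
proof -
  have [measurable]: "(\<lambda>w. set_passage_time w I z) \<in> borel_measurable (PiM edges (\<lambda>_. borel))" for I z
    by (rule borel_measurable_set_passage_time)
  show ?thesis
    unfolding type2_survives_def infinite_sites_iff occupied2_def mem_Collect_eq by measurable
qed

lemma passage_time_cong:
  assumes "\<And>e. e \<in> edges \<Longrightarrow> w e = w' e"
  shows "passage_time w x y = passage_time w' x y"
proof -
  have "path_time w p = path_time w' p" if "path_between x y p" for p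
    unfolding path_time_def using that by (intro sum.cong assms path_edge) (auto simp: path_between_def)
  then show ?thesis unfolding passage_time_def by (intro INF_cong) auto
qed

lemma type2_survives_cong:
  assumes "\<And>e. e \<in> edges \<Longrightarrow> w e = w' e"
  shows "type2_survives w I1 I2 \<longleftrightarrow> type2_survives w' I1 I2"
  unfolding type2_survives_def occupied2_def set_passage_time_def
  by (simp add: passage_time_cong[OF assms])

section \<open>Translations of the lattice and of the weights\<close>

definition shift_edge :: "site \<Rightarrow> site set \<Rightarrow> site set" where
  "shift_edge x e = (\<lambda>z. z + x) ` e"

lemma adj_add_right [simp]: "adj (x + z) (y + z) \<longleftrightarrow> adj x y"
  by (simp add: adj_def)

lemma shift_edge_mem: "e \<in> edges \<Longrightarrow> shift_edge x e \<in> edges"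
  unfolding edges_def shift_edge_def
proof (elim CollectE exE conjE)
  fix a b assume "e = {a, b}" "adj a b"
  then show "(\<lambda>z. z + x) ` e \<in> {{x, y} | x y. adj x y}"
    by (intro CollectI exI[of _ "a + x"] exI[of _ "b + x"]) simp
qed

lemma inj_shift_edge: "inj_on (shift_edge x) E"
  unfolding shift_edge_def by (auto simp: inj_on_def inj_image_eq_iff)

lemma path_between_translate:
  "path_between (x + a) (y + a) (map (\<lambda>z. z + a) p) \<longleftrightarrow> path_between x y p"
  unfolding path_between_def is_path_def by (cases "p = []") (auto simp: hd_map last_map)

lemma passage_time_translate:
  "passage_time w (x + a) (y + a) = passage_time (\<lambda>e. w (shift_edge a e)) x y"
proof -
  have time: "path_time w (map (\<lambda>z. z + a) p) = path_time (\<lambda>e. w (shift_edge a e)) p" for p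
    unfolding path_time_def shift_edge_def by (intro sum.cong) auto
  have "path_between (x + a) (y + a) q \<longleftrightarrow> q \<in> map (\<lambda>z. z + a) ` {p. path_between x y p}" for q
  proof
    assume *: "path_between (x + a) (y + a) q"
    have "q = map (\<lambda>z. z + a) (map (\<lambda>z. z - a) q)" by (simp add: o_def)
    then show "q \<in> map (\<lambda>z. z + a) ` {p. path_between x y p}"
      using * path_between_translate[of x a y "map (\<lambda>z. z - a) q"] by (intro image_eqI) auto
  qed (auto simp: path_between_translate)
  then have "{q. path_between (x + a) (y + a) q} = map (\<lambda>z. z + a) ` {p. path_between x y p}" by blast
  then show ?thesis unfolding passage_time_def by (simp add: image_image time)
qed

text \<open>Moving both initial sets by \<open>a\<close> amounts to reading the weights from
  \<open>a\<close>. This reduces survival from any site to survival from the origin.\<close>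

lemma type2_survives_translate:
  "type2_survives w ((\<lambda>z. z + a) ` I1) ((\<lambda>z. z + a) ` I2)
    \<longleftrightarrow> type2_survives (\<lambda>e. w (shift_edge a e)) I1 I2"
proof -
  have time: "set_passage_time w ((\<lambda>z. z + a) ` I) (z + a) = set_passage_time (\<lambda>e. w (shift_edge a e)) I z" for I z
    unfolding set_passage_time_def by (simp add: image_image passage_time_translate)
  have "occupied2 w ((\<lambda>z. z + a) ` I1) ((\<lambda>z. z + a) ` I2)
      = (\<lambda>z. z + a) ` occupied2 (\<lambda>e. w (shift_edge a e)) I1 I2"
  proof (intro set_eqI)
    fix z
    show "z \<in> occupied2 w ((\<lambda>z. z + a) ` I1) ((\<lambda>z. z + a) ` I2)
        \<longleftrightarrow> z \<in> (\<lambda>z. z + a) ` occupied2 (\<lambda>e. w (shift_edge a e)) I1 I2"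
      using time[of I1 "z - a"] time[of I2 "z - a"]
      by (auto simp: occupied2_def simp del: split_paired_Ex intro!: image_eqI[of _ _ "z - a"])
  qed
  then show ?thesis
    unfolding type2_survives_def by (simp add: finite_image_iff)
qed

theorem theorem4:
  fixes M :: "'a measure" and \<omega> :: "site set \<Rightarrow> 'a \<Rightarrow> real"
    and \<nu> :: "real measure" and \<theta> \<alpha> :: real
  assumes "prob_space M"
    and indep: "prob_space.indep_vars M (\<lambda>_. borel) \<omega> edges"
    and ident: "\<And>e. e \<in> edges \<Longrightarrow> distr M borel (\<omega> e) = \<nu>"
    and continuous: "continuous_on UNIV (cdf \<nu>)"
    and nonneg: "AE t in \<nu>. 0 \<le> t"
    and moment: "integrable (PiM {1..4::nat} (\<lambda>_. \<nu>)) (\<lambda>t. (Min (t ` {1..4}))\<^sup>2)"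
    and "0 \<le> \<theta>" and "\<theta> < 2 * pi"
    and geodesic: "AE s in M. \<exists>v \<in> geodesics_from_origin (\<lambda>e. \<omega> e s).
       busemann_asymp_linear (asymptotic_shape M \<omega>) (\<lambda>e. \<omega> e s) v \<theta>"
    and "0 \<le> \<alpha>" and "\<alpha> \<le> pi"
  shows "event_G M \<omega> \<theta> \<alpha> \<in> sets M \<and>
    (\<alpha> < pi / 2 \<longrightarrow> measure M (event_G M \<omega> \<theta> \<alpha>) > 0) \<and>
    (\<alpha> > pi / 2 \<longrightarrow> measure M (event_G M \<omega> \<theta> \<alpha>) = 0)"
proof -
  interpret prob_space M by fact
  define I where "I = {z. emb z \<in> cone \<theta> \<alpha> - {0}}"
  define P where "P = PiM edges (\<lambda>_. borel :: real measure)"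
  define S where "S w \<longleftrightarrow> type2_survives w I {0}" for w
  \<comment> \<open>The product space consists of extensional functions, hence the restriction to
    \<open>edges\<close>.\<close>
  define X where "X s = restrict (\<lambda>e. \<omega> e s) edges" for s
  have rv: "random_variable borel (\<omega> e)" if "e \<in> edges" for e
    using indep that by (auto simp: indep_vars_def)
  have X: "X \<in> M \<rightarrow>\<^sub>M P"
    unfolding X_def P_def using rv by (intro measurable_restrict)
  have S_sets: "{w \<in> space P. S w} \<in> sets P"
    unfolding P_def S_def by (rule sets_type2_survives)
  have event: "event_G M \<omega> \<theta> \<alpha> = {s \<in> space M. S (X s)}"
    unfolding event_G_def S_def I_def X_def by (intro Collect_cong conj_cong type2_survives_cong) auto
  have "event_G M \<omega> \<theta> \<alpha> = X -` {w \<in> space P. S w} \<inter> space M"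
    using measurable_space[OF X] by (auto simp: event)
  then have event_sets: "event_G M \<omega> \<theta> \<alpha> \<in> sets M"
    using measurable_sets[OF X S_sets] by simp
  obtain e0 where e0: "e0 \<in> edges" using edges_nonempty by blast
  have \<nu>: "prob_space \<nu>" "sets \<nu> = sets borel"
    using prob_space_distr[OF rv[OF e0]] ident[OF e0] by auto
  have distr_X: "distr M P X = PiM edges (\<lambda>_. \<nu>)"
  proof -
    have "distr M P X = PiM edges (\<lambda>e. distr M borel (\<omega> e))"
      unfolding P_def X_def using indep_vars_iff_distr_eq_PiM'[OF edges_nonempty, of \<omega> "\<lambda>_. borel"] rv indep by blast
    then show ?thesis by (simp add: ident cong: PiM_cong)
  qed
  have nonneg_AE: "AE s in M. nonneg_weights (\<lambda>e. \<omega> e s)"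
    unfolding nonneg_weights_def
  proof (subst AE_ball_countable[OF countable_edges], intro ballI)
    fix e assume e: "e \<in> edges"
    have "AE t in distr M borel (\<omega> e). 0 \<le> t" unfolding ident[OF e] by (rule nonneg)
    then show "AE s in M. 0 \<le> \<omega> e s" by (rule AE_distrD[OF rv[OF e]])
  qed
  \<comment> \<open>If the event were null, translation invariance would almost surely rule out
    survival from every site \<open>x\<close> against its translated cone, yet some \<open>x\<close>
    survives.\<close>
  have "measure M (event_G M \<omega> \<theta> \<alpha>) > 0" if "\<alpha> < pi / 2"
  proof (rule ccontr)
    assume "\<not> measure M (event_G M \<omega> \<theta> \<alpha>) > 0"
    then have "prob (event_G M \<omega> \<theta> \<alpha>) = 0" using measure_nonneg[of M "event_G M \<omega> \<theta> \<alpha>"] by linarith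
    then have "AE s in M. s \<notin> event_G M \<omega> \<theta> \<alpha>"
      using prob_eq_0[OF event_sets] by simp
    then have "AE s in M. \<not> S (X s)" by (auto simp: event)
    moreover have "{w \<in> space P. \<not> S w} \<in> sets P" using S_sets by (rule sets.sets_Collect_neg)
    ultimately have ext: "AE w in PiM edges (\<lambda>_. \<nu>). \<not> S w"
      unfolding distr_X[symmetric] using AE_distr_iff[OF X, of "\<lambda>w. \<not> S w"] by blast
    have "AE s in M. \<not> S (\<lambda>e. \<omega> (shift_edge x e) s)" for x
    proof -
      define \<tau> where "\<tau> w = restrict (\<lambda>e. w (shift_edge x e)) edges" for w :: "site set \<Rightarrow> real"
      \<comment> \<open>\<open>shift_edge x\<close> maps \<open>edges\<close> injectively into
        itself, so reindexing by it preserves the i.i.d. law.\<close>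
      have \<tau>_distr: "distr (PiM edges (\<lambda>_. \<nu>)) (PiM edges (\<lambda>_. \<nu>)) \<tau> = PiM edges (\<lambda>_. \<nu>)"
        unfolding \<tau>_def using \<nu>(1) inj_shift_edge shift_edge_mem
        by (intro distr_PiM_reindex[where M = "\<lambda>_. \<nu>"]) auto
      have \<tau>: "\<tau> \<in> PiM edges (\<lambda>_. \<nu>) \<rightarrow>\<^sub>M PiM edges (\<lambda>_. \<nu>)"
        unfolding \<tau>_def using shift_edge_mem by (intro measurable_restrict measurable_component_singleton)
      have "AE w in distr (PiM edges (\<lambda>_. \<nu>)) (PiM edges (\<lambda>_. \<nu>)) \<tau>. \<not> S w"
        unfolding \<tau>_distr by (rule ext)
      then have "AE w in distr M P X. \<not> S (\<tau> w)"
        unfolding distr_X by (rule AE_distrD[OF \<tau>])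
      then have "AE s in M. \<not> S (\<tau> (X s))"
        by (rule AE_distrD[OF X])
      moreover have "S (\<tau> (X s)) \<longleftrightarrow> S (\<lambda>e. \<omega> (shift_edge x e) s)" for s
        unfolding S_def by (intro type2_survives_cong) (simp add: \<tau>_def X_def shift_edge_mem)
      ultimately show ?thesis by simp
    qed
    then have "AE s in M. \<forall>x. \<not> S (\<lambda>e. \<omega> (shift_edge x e) s)" by (simp add: AE_all_countable)
    with geodesic nonneg_AE have "AE s in M. False"
    proof eventually_elim
      case (elim s)
      then obtain x where "type2_survives (\<lambda>e. \<omega> e s) {z. emb (z - x) \<in> cone \<theta> \<alpha> - {0}} {x}"
        using exists_translate_type2_survives \<open>0 \<le> \<alpha>\<close> \<open>\<alpha> < pi / 2\<close> by blast
      moreover have "{z. emb (z - x) \<in> cone \<theta> \<alpha> - {0}} = (\<lambda>z. z + x) ` I"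
      proof (intro equalityI subsetI)
        fix z assume "z \<in> {z. emb (z - x) \<in> cone \<theta> \<alpha> - {0}}"
        then show "z \<in> (\<lambda>z. z + x) ` I" by (intro image_eqI[of _ _ "z - x"]) (auto simp: I_def)
      qed (auto simp: I_def simp flip: zero_prod_def)
      ultimately have "S (\<lambda>e. \<omega> (shift_edge x e) s)"
        using type2_survives_translate[of "\<lambda>e. \<omega> e s" x I "{0}"] by (simp add: S_def)
      then show False using elim by blast
    qed
    then show False by (simp add: AE_False)
  qed
  moreover have "measure M (event_G M \<omega> \<theta> \<alpha>) = 0" if "pi / 2 < \<alpha>"
  proof -
    from geodesic nonneg_AE have "AE s in M. s \<notin> event_G M \<omega> \<theta> \<alpha>"
    proof eventually_elim
      case (elim s)
      then show ?case
        using finite_occupied2_wide_cone that \<open>\<alpha> \<le> pi\<close> unfolding event_G_def type2_survives_def by blast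
    qed
    then show ?thesis using prob_eq_0[OF event_sets] by simp
  qed
  ultimately show ?thesis using event_sets by blast
qed

end
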